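(* Let $m\ge n$, $0\le r<n$, $A^1,\dots,A^l\in\mathbb{R}^{m\times n}$, $b\in\mathbb{R}^l$, and $X\in\mathcal{L}\cap\mathcal{M}(r)$ with $s=\operatorname{rank}(X)$ and SVD $X=U\Sigma V^\top$ as in the context. (i) If $s=r$ and Assumption 1 holds at $X$, then $\mathrm{N}^F_{\mathcal{L}\cap\mathcal{M}(r)}(X)=\mathrm{N}_{\mathcal{L}}(X)+\mathrm{N}^F_{\mathcal{M}(r)}(X)$. (ii) If $s<r$ and Assumption 2 holds at $X$, then $\mathrm{N}^F_{\mathcal{L}\cap\mathcal{M}(r)}(X)=\mathrm{N}_{\mathcal{L}}(X)+\mathrm{N}^F_{\mathcal{M}(r)}(X)=\mathrm{N}_{\mathcal{L}}(X)$.
   Context: $\langle X,Y\rangle=\sum_{i,j}X_{ij}Y_{ij}$. $\mathcal{A}(X)=(\langle A^1,X\rangle,\dots,\langle A^l,X\rangle)^\top$, $\mathcal{L}=\{X:\mathcal{A}(X)=b\}$, $\mathrm{N}_{\mathcal{L}}(X)=\{\sum_i y_iA^i:y\in\mathbb{R}^l\}$, $\mathcal{M}(r)=\{X:\operatorname{rank}(X)\le r\}$. For closed $\Omega$ and $X\in\Omega$: $\mathrm{T}^B_\Omega(X)$ is the set of $\Xi$ with $X^k\in\Omega$, $X^k\to X$, $t_k\downarrow0$, $(X^k-X)/t_k\to\Xi$; $\mathrm{N}^F_\Omega(X)=\{Y:\langle Y,\Xi\rangle\le0\ \forall\Xi\in\mathrm{T}^B_\Omega(X)\}$. SVD convention: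 $X=U\Sigma V^\top$, $U$, $V$ orthogonal of sizes $m$, $n$, $\Sigma$ with diagonal $\sigma_1\ge\dots\ge\sigma_s>0$ followed by zeros, $\Gamma=\{1,\dots,s\}$, $\Gamma_m^\perp=\{s+1,\dots,m\}$, $\Gamma_n^\perp=\{s+1,\dots,n\}$, $U_J,V_J$ column submatrices indexed by $J$. Define $T^i_X=\begin{bmatrix}U_\Gamma^\top A^iV_\Gamma & U_\Gamma^\top A^iV_{\Gamma_n^\perp}\\ U_{\Gamma_m^\perp}^\top A^iV_\Gamma & O\end{bmatrix}$ and $R^i_X=U^\top A^iV_\Gamma$, $i=1,\dots,l$. Assumption 1 at $X$: $T^1_X,\dots,T^l_X$ linearly independent. Assumption 2 at $X$: $R^1_X,\dots,R^l_X$ linearly independent. *)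

theory Defs
  imports "Jordan_Normal_Form.DL_Rank"
begin

definition frob_inner :: "real mat \<Rightarrow> real mat \<Rightarrow> real" where
  "frob_inner X Y = (\<Sum>i<dim_row X. \<Sum>j<dim_col X. X $$ (i,j) * Y $$ (i,j))"

definition mrank :: "real mat \<Rightarrow> nat" where
  "mrank X = vec_space.rank (dim_row X) X"

definition affL :: "nat \<Rightarrow> nat \<Rightarrow> nat \<Rightarrow> (nat \<Rightarrow> real mat) \<Rightarrow> (nat \<Rightarrow> real) \<Rightarrow> real mat set" where
  "affL m n l A b = {X \<in> carrier_mat m n. \<forall>i<l. frob_inner (A i) X = b i}"

definition normL :: "nat \<Rightarrow> nat \<Rightarrow> nat \<Rightarrow> (nat \<Rightarrow> real mat) \<Rightarrow> real mat set" where
  "normL m n l A = {mat m n (\<lambda>(p,q). \<Sum>i<l. y i * A i $$ (p,q)) | y :: nat \<Rightarrow> real. True}"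

definition lowrank :: "nat \<Rightarrow> nat \<Rightarrow> nat \<Rightarrow> real mat set" where
  "lowrank m n r = {X \<in> carrier_mat m n. mrank X \<le> r}"

text \<open>entrywise (= norm) convergence of a sequence of m x n matrices\<close>
definition mat_tendsto :: "nat \<Rightarrow> nat \<Rightarrow> (nat \<Rightarrow> real mat) \<Rightarrow> real mat \<Rightarrow> bool" where
  "mat_tendsto m n Xs X \<longleftrightarrow> (\<forall>i<m. \<forall>j<n. (\<lambda>k. Xs k $$ (i,j)) \<longlonglongrightarrow> X $$ (i,j))"

definition bouligand_tangent :: "nat \<Rightarrow> nat \<Rightarrow> real mat set \<Rightarrow> real mat \<Rightarrow> real mat set" where
  "bouligand_tangent m n \<Omega> X = {\<Xi> \<in> carrier_mat m n. \<exists>(Xs :: nat \<Rightarrow> real mat) (t :: nat \<Rightarrow> real).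
      (\<forall>k. Xs k \<in> \<Omega>) \<and> mat_tendsto m n Xs X \<and> (\<forall>k. t k > 0) \<and> t \<longlonglongrightarrow> 0 \<and>
      mat_tendsto m n (\<lambda>k. (1 / t k) \<cdot>\<^sub>m (Xs k - X)) \<Xi>}"

definition frechet_normal :: "nat \<Rightarrow> nat \<Rightarrow> real mat set \<Rightarrow> real mat \<Rightarrow> real mat set" where
  "frechet_normal m n \<Omega> X = {Y \<in> carrier_mat m n. \<forall>\<Xi> \<in> bouligand_tangent m n \<Omega> X. frob_inner Y \<Xi> \<le> 0}"

definition mset_plus :: "real mat set \<Rightarrow> real mat set \<Rightarrow> real mat set" where
  "mset_plus S T = {P + Q | P Q. P \<in> S \<and> Q \<in> T}"

text \<open>column submatrix with columns k0, ..., k1-1 (0-based), i.e. U_J for J = {k0+1..k1}\<close>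
definition col_sub :: "real mat \<Rightarrow> nat \<Rightarrow> nat \<Rightarrow> real mat" where
  "col_sub U k0 k1 = mat (dim_row U) (k1 - k0) (\<lambda>(i,j). U $$ (i, k0 + j))"

definition is_svd :: "nat \<Rightarrow> nat \<Rightarrow> real mat \<Rightarrow> nat \<Rightarrow> real mat \<Rightarrow> real mat \<Rightarrow> real mat \<Rightarrow> bool" where
  "is_svd m n X s U \<Sigma> V \<longleftrightarrow>
     U \<in> carrier_mat m m \<and> V \<in> carrier_mat n n \<and> \<Sigma> \<in> carrier_mat m n \<and>
     transpose_mat U * U = 1\<^sub>m m \<and> transpose_mat V * V = 1\<^sub>m n \<and>
     (\<forall>i<m. \<forall>j<n. i \<noteq> j \<longrightarrow> \<Sigma> $$ (i,j) = 0) \<and>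
     (\<forall>i<s. \<Sigma> $$ (i,i) > 0) \<and>
     (\<forall>i j. i \<le> j \<longrightarrow> j < s \<longrightarrow> \<Sigma> $$ (j,j) \<le> \<Sigma> $$ (i,i)) \<and>
     (\<forall>i. s \<le> i \<longrightarrow> i < min m n \<longrightarrow> \<Sigma> $$ (i,i) = 0) \<and>
     X = U * \<Sigma> * transpose_mat V"

definition T_mat :: "nat \<Rightarrow> nat \<Rightarrow> nat \<Rightarrow> real mat \<Rightarrow> real mat \<Rightarrow> real mat \<Rightarrow> real mat" where
  "T_mat m n s U V Ai = four_block_mat
      (transpose_mat (col_sub U 0 s) * Ai * col_sub V 0 s)
      (transpose_mat (col_sub U 0 s) * Ai * col_sub V s n)
      (transpose_mat (col_sub U s m) * Ai * col_sub V 0 s)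
      (0\<^sub>m (m - s) (n - s))"

definition R_mat :: "nat \<Rightarrow> real mat \<Rightarrow> real mat \<Rightarrow> real mat \<Rightarrow> real mat" where
  "R_mat s U V Ai = transpose_mat U * Ai * col_sub V 0 s"

definition lin_indep_mats :: "nat \<Rightarrow> nat \<Rightarrow> nat \<Rightarrow> (nat \<Rightarrow> real mat) \<Rightarrow> bool" where
  "lin_indep_mats p q l M \<longleftrightarrow>
     (\<forall>c :: nat \<Rightarrow> real. (\<forall>i<p. \<forall>j<q. (\<Sum>k<l. c k * M k $$ (i,j)) = 0) \<longrightarrow> (\<forall>k<l. c k = 0))"

end

(*
  Write X = P Q with P = U_Gamma Sigma_Gamma and Q = V_Gamma^T.  If s = r, every (P + P') (Q + Q') has rank at
  most r, and Assumption 1 says exactly that the constraints, linearised in (P', Q'), are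
  independent.  The remaining error is quadratic, so a contraction argument corrects any
  direction P' Q + P Q' in the kernel of the constraints to a curve in the feasible set; hence a
  normal Y agrees with some combination of the A^i on all directions P' Q + P Q'.  The difference
  lives in the block complementary to U_Gamma, V_Gamma, on which tangents to the rank variety vanish.

  If s < r, a rank-one matrix can be added to P' Q for free, Assumption 2 lets P' alone restore
  the constraints, and the feasible set contains whole lines through X in enough directions to
  force Y into the span of the A^i.
*)
theory Submission
  imports Defs
begin

section \<open>Rank and factorizations\<close>

text \<open>The constraints are equalities and must hold exactly along a curve, so a direction in
  their kernel has to be bent. Independence of the linearised constraints supplies directions dual
  to them, in whose coordinates the linearisation is the identity. If the direction is corrected by
  \<open>t * v\<close>, dividing the constraints by the square of \<open>t\<close> leaves an
  equation for \<open>v\<close> with a constant term, a linear term of order \<open>t\<close> and a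
  quadratic term of order \<open>t\<close> squared. Its solutions stay in a box independent of
  \<open>t\<close>, so the correction disappears in the limit and the prescribed direction is
  tangent. The same dual directions produce the multipliers: a functional that vanishes on the joint
  kernel is the combination of the constraints whose coefficients are its values on them. In the
  rank-deficient case \<open>Q\<close> stays fixed, the perturbation is linear in \<open>t\<close>,
  and straight lines take the place of curves. Of the tangent cone of the rank variety only an upper
  bound enters, the vanishing of one block, obtained from bordered minors. The inclusion of the sum
  of the two normal cones in the normal cone of the intersection is soft: a tangent to the
  intersection is tangent to both sets.\<close>

lemma mrank_mult_le:
  assumes P: "P \<in> carrier_mat m p" and Q: "Q \<in> carrier_mat p n"
  shows "mrank (P * Q) \<le> p"
proof -
  interpret vec_space "TYPE(real)" m .
  have PQ: "P * Q \<in> carrier_mat m n" using P Q by simp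
  define W where "W = span (set (cols P))"
  have sub: "set (cols (P * Q)) \<subseteq> W"
  proof
    fix x assume "x \<in> set (cols (P * Q))"
    then obtain j where j: "j < n" "x = col (P * Q) j"
      using PQ by (metis carrier_matD(2) cols_length cols_nth in_set_conv_nth)
    have "x = P *\<^sub>v col Q j" using j col_mult2[OF P Q] by simp
    moreover have "col Q j \<in> carrier_vec p" using Q j by auto
    ultimately have "x \<in> col_space P"
      using col_space_eq[OF P] P by auto
    then show "x \<in> W" by (simp add: W_def col_space_def)
  qed
  have Psub: "set (cols P) \<subseteq> carrier_vec m" using cols_dim P by blast
  have W: "subspace class_ring W V" unfolding W_def using Psub by (rule span_is_subspace)
  have "set (cols (P * Q)) \<subseteq> carrier_vec m" using cols_dim PQ by blast
  then have W': "subspace class_ring (span (set (cols (P * Q)))) V" by (rule span_is_subspace)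
  have "span (set (cols (P * Q))) \<subseteq> W"
    using sub W by (simp add: span_is_subset subspace_def)
  then have nest: "subspace class_ring (span (set (cols (P * Q)))) (vs W)"
    by (rule nested_subspaces[OF W W'])
  have "rank (P * Q) \<le> rank P"
    using vectorspace.subspace_dim[OF subspace_is_vs[OF W] nest] fin_dim_span_cols[OF P]
      fin_dim_span_cols[OF PQ] by (simp add: rank_def W_def)
  also have "\<dots> \<le> p" by (rule rank_le_nc[OF P])
  finally show ?thesis using P by (simp add: mrank_def)
qed

text \<open>A maximal independent set \<open>S\<close> of columns has as many elements as the rank
  and spans every column: \<open>P\<close> lists \<open>S\<close>, and \<open>Q\<close> holds the
  coefficients.\<close>

lemma mrank_factorization:
  assumes X: "X \<in> carrier_mat m n" and r: "mrank X \<le> p"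
  obtains P Q where "P \<in> carrier_mat m p" "Q \<in> carrier_mat p n" "X = P * Q"
proof -
  interpret vec_space "TYPE(real)" m .
  have Xsub: "set (cols X) \<subseteq> carrier_vec m" using cols_dim X by blast
  have li0: "lin_indpt {}"
    using finite_basis_exists[OF fin_dim] subset_li_is_li[of _ "{}"] by (auto simp: basis_def)
  obtain S where S: "maximal S (\<lambda>T. T \<subseteq> set (cols X) \<and> lin_indpt T)" "finite S"
    using maximal_exists_superset[of "set (cols X)" "\<lambda>T. T \<subseteq> set (cols X) \<and> lin_indpt T" "{}"]
    li0 by (metis (no_types, lifting) List.finite_set empty_subsetI)
  have SX: "S \<subseteq> set (cols X)" and li: "lin_indpt S" using S(1) by (auto simp: maximal_def)
  have Sm: "S \<subseteq> carrier_vec m" using SX Xsub by blast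
  have cS: "card S \<le> p" using rank_card_indpt[OF X S(1)] r X by (simp add: mrank_def)
  have inspan: "x \<in> span S" if "x \<in> set (cols X)" for x
  proof (rule ccontr)
    assume n: "x \<notin> span S"
    then have nS: "x \<notin> S" using Sm span_mem by blast
    have "x \<in> carrier_vec m" using that Xsub by blast
    then have "lin_indpt (S \<union> {x})" using n nS lin_dep_iff_in_span[OF Sm li _ nS] by simp
    moreover have "S \<union> {x} \<subseteq> set (cols X)" using that SX by simp
    ultimately show False using S(1) nS unfolding maximal_def by blast
  qed
  have "\<exists>a. col X j = lincomb a S" if "j < n" for j
  proof -
    have "col X j \<in> span S"
      using inspan that X by (metis carrier_matD(2) cols_length cols_nth nth_mem)
    then obtain a where "lincomb a S = col X j"
      using finite_in_span[OF S(2)] Sm by force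
    then show ?thesis by metis
  qed
  then obtain a where a: "\<And>j. j < n \<Longrightarrow> col X j = lincomb (a j) S" by metis
  obtain xs where xs: "set xs = S" "distinct xs" using finite_distinct_list[OF S(2)] by blast
  have len: "length xs = card S" using xs distinct_card by fastforce
  \<comment> \<open>The rank may be smaller than \<open>p\<close>; the surplus columns of
    \<open>P\<close> and rows of \<open>Q\<close> are filled with zeros.\<close>
  define P where "P = mat m p (\<lambda>(i,k). if k < card S then (xs ! k) $ i else 0)"
  define Q where "Q = mat p n (\<lambda>(k,j). if k < card S then a j (xs ! k) else 0)"
  have "X = P * Q"
  proof (rule eq_matI)
    fix i j assume "i < dim_row (P * Q)" "j < dim_col (P * Q)"
    then have ij: "i < m" "j < n" by (auto simp: P_def Q_def)
    have "X $$ (i,j) = lincomb (a j) S $ i" using a[OF ij(2)] ij X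
      by (metis carrier_matD index_col)
    also have "\<dots> = (\<Sum>x\<in>S. a j x * x $ i)" by (rule lincomb_index[OF ij(1) Sm])
    also have "\<dots> = (\<Sum>k<card S. a j (xs ! k) * (xs ! k) $ i)"
      using sum.reindex_bij_betw[OF bij_betw_nth[OF xs(2), of "{..<card S}" S]] len xs(1)
      by (metis (no_types, lifting) sum.cong)
    also have "\<dots> = (\<Sum>k<p. if k < card S then a j (xs ! k) * (xs ! k) $ i else 0)"
    proof -
      have "{..<p} \<inter> {k. k < card S} = {..<card S}" using cS by auto
      then show ?thesis by (simp add: sum.If_cases)
    qed
    also have "\<dots> = (P * Q) $$ (i,j)"
      using ij by (auto simp: P_def Q_def scalar_prod_def atLeast0LessThan intro!: sum.cong)
    finally show "X $$ (i,j) = (P * Q) $$ (i,j)" .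
  qed (use X in \<open>auto simp: P_def Q_def\<close>)
  moreover have "P \<in> carrier_mat m p" "Q \<in> carrier_mat p n" by (auto simp: P_def Q_def)
  ultimately show thesis using that by blast
qed

text \<open>The square product factors through a space of dimension \<open>mrank X < p\<close>. With
  \<open>F\<close> and \<open>G\<close> selecting, rotating and rescaling rows and columns, this is
  the vanishing of minors.\<close>

lemma det_mult_low_mrank:
  assumes X: "X \<in> carrier_mat m n" and r: "mrank X < p"
    and F: "F \<in> carrier_mat p m" and G: "G \<in> carrier_mat n p"
  shows "det (F * X * G) = 0"
proof -
  obtain P Q where PQ: "P \<in> carrier_mat m (mrank X)" "Q \<in> carrier_mat (mrank X) n" "X = P * Q"
    using mrank_factorization[OF X order_refl] .
  have "F * X * G = (F * P) * (Q * G)"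
    using assoc_mult_mat[OF F PQ(1,2)] assoc_mult_mat[OF mult_carrier_mat[OF F PQ(1)] PQ(2) G] PQ(3)
    by simp
  then have "mrank (F * X * G) \<le> mrank X"
    using mrank_mult_le[of "F * P" p "mrank X" "Q * G" p] F G PQ(1,2) by (metis mult_carrier_mat)
  moreover have c: "F * X * G \<in> carrier_mat p p" using F G X by simp
  moreover have "dim_row (F * X * G) = p" using F by simp
  ultimately show ?thesis using vec_space.det_rank_iff[OF c] r by (auto simp: mrank_def)
qed

section \<open>Linear functionals and quadratic systems\<close>

text \<open>Vectors are plain functions on an arbitrary index type, which avoids carrier conditions
  and lets one theory serve both parametrisations below, by \<open>nat \<times> nat\<close> and by
  \<open>bool \<times> nat \<times> nat\<close>.\<close>

definition linear_functional :: "(('a \<Rightarrow> real) \<Rightarrow> real) \<Rightarrow> bool" where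
  "linear_functional f \<longleftrightarrow> (\<forall>u v a. f (\<lambda>x. u x + a * v x) = f u + a * f v)"

lemma linear_functionalD:
  "linear_functional f \<Longrightarrow> f (\<lambda>x. u x + a * v x) = f u + a * f v"
  by (simp add: linear_functional_def)

lemma linear_functional_zero:
  assumes "linear_functional f"
  shows "f (\<lambda>x. 0) = 0"
proof -
  have "f (\<lambda>x. 0 + 1 * 0) = f (\<lambda>x. 0) + 1 * f (\<lambda>x. 0)"
    by (rule linear_functionalD[OF assms])
  then show ?thesis by simp
qed

lemma linear_functional_scale:
  assumes "linear_functional f"
  shows "f (\<lambda>x. a * u x) = a * f u"
proof -
  have "f (\<lambda>x. 0 + a * u x) = f (\<lambda>x. 0) + a * f u"
    by (rule linear_functionalD[OF assms])
  then show ?thesis using linear_functional_zero[OF assms] by simp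
qed

lemma linear_functional_add_sum:
  assumes f: "linear_functional f"
  shows "f (\<lambda>x. u x + (\<Sum>j<(l::nat). c j * w j x)) = f u + (\<Sum>j<l. c j * f (w j))"
proof (induction l)
  case (Suc l)
  have "f (\<lambda>x. u x + (\<Sum>j<Suc l. c j * w j x)) = f (\<lambda>x. (u x + (\<Sum>j<l. c j * w j x)) + c l * w l x)"
    by (simp add: add.assoc)
  also have "\<dots> = f (\<lambda>x. u x + (\<Sum>j<l. c j * w j x)) + c l * f (w l)"
    by (rule linear_functionalD[OF f])
  finally show ?case using Suc.IH by simp
qed simp

text \<open>Biorthogonalisation by induction: independence gives a vector on which the new
  functional differs from its projection onto the old ones, and subtracting projections restores
  duality.\<close>

lemma dual_basis_exists:
  fixes f :: "nat \<Rightarrow> ('a \<Rightarrow> real) \<Rightarrow> real"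
  assumes "\<And>k. k < l \<Longrightarrow> linear_functional (f k)"
    and "\<And>c. (\<And>u. (\<Sum>k<l. c k * f k u) = 0) \<Longrightarrow> \<forall>k<l. c k = 0"
  shows "\<exists>w. \<forall>k<l. \<forall>j<l. f k (w j) = (if k = j then 1 else 0)"
  using assms
proof (induction l)
  case (Suc l)
  have "\<exists>w. \<forall>k<l. \<forall>j<l. f k (w j) = (if k = j then 1 else 0)"
  proof (rule Suc.IH)
    fix c :: "nat \<Rightarrow> real" assume c: "\<And>u. (\<Sum>k<l. c k * f k u) = 0"
    have "\<forall>k<Suc l. (c(l := 0)) k = 0"
      by (rule Suc.prems(2)) (use c in simp)
    then show "\<forall>k<l. c k = 0" by (metis fun_upd_apply less_SucI nat_neq_iff)
  qed (use Suc.prems(1) in simp)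
  then obtain w where w: "\<And>k j. k < l \<Longrightarrow> j < l \<Longrightarrow> f k (w j) = (if k = j then 1 else 0)" by blast
  \<comment> \<open>Otherwise \<open>f l\<close> is a combination of the earlier functionals, a
    relation with coefficient 1 at \<open>l\<close>.\<close>
  have "\<exists>u. f l u - (\<Sum>k<l. f l (w k) * f k u) \<noteq> 0"
  proof (rule ccontr)
    assume *: "\<not> ?thesis"
    have "(\<Sum>k<Suc l. (if k = l then 1 else - f l (w k)) * f k u) = 0" for u
    proof -
      have "(\<Sum>k<Suc l. (if k = l then 1 else - f l (w k)) * f k u) = f l u - (\<Sum>k<l. f l (w k) * f k u)"
        by (simp add: sum_negf)
      then show ?thesis using * by metis
    qed
    then have "\<forall>k<Suc l. (if k = l then 1 else - f l (w k)) = 0" by (rule Suc.prems(2))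
    then show False by (metis lessI zero_neq_one)
  qed
  then obtain u where u: "f l u - (\<Sum>k<l. f l (w k) * f k u) \<noteq> 0" by blast
  define d where "d = f l u - (\<Sum>k<l. f l (w k) * f k u)"
  \<comment> \<open>Removing the old dual components of \<open>u\<close> makes every earlier
    functional vanish; the factor \<open>1 / d\<close> normalises \<open>f l z\<close> to 1.\<close>
  define z where "z = (\<lambda>x. (1 / d) * (u x + (\<Sum>k<l. - f k u * w k x)))"
  have fz: "f k z = (1 / d) * (f k u + (\<Sum>j<l. - f j u * f k (w j)))" if "k < Suc l" for k
    unfolding z_def linear_functional_scale[OF Suc.prems(1)[OF that]]
      linear_functional_add_sum[OF Suc.prems(1)[OF that]] ..
  have fzl: "f l z = 1"
    using u by (simp add: fz sum_negf d_def mult.commute)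
  have fzk: "f k z = 0" if "k < l" for k
  proof -
    have "(\<Sum>j<l. - f j u * f k (w j)) = (\<Sum>j<l. if k = j then - f j u else 0)"
      using that by (intro sum.cong) (auto simp: w)
    then show ?thesis using that by (simp add: fz)
  qed
  \<comment> \<open>The old dual vectors lose their \<open>f l\<close> component along
    \<open>z\<close>; as earlier functionals vanish at \<open>z\<close>, the old duality relations
    survive.\<close>
  define w' where "w' = (\<lambda>j. if j = l then z else (\<lambda>x. w j x + (- f l (w j)) * z x))"
  have fw': "f k (w' j) = f k (w j) + (- f l (w j)) * f k z" if "k < Suc l" "j < l" for k j
  proof -
    have "f k (\<lambda>x. w j x + (- f l (w j)) * z x) = f k (w j) + (- f l (w j)) * f k z"
      by (rule linear_functionalD[OF Suc.prems(1)[OF that(1)]])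
    then show ?thesis using that by (simp add: w'_def)
  qed
  have "f k (w' j) = (if k = j then 1 else 0)" if "k < Suc l" "j < Suc l" for k j
    using that fw'[of k j] fzl fzk[of k] w[of k j]
    by (cases "j = l"; cases "k = l") (auto simp: w'_def less_Suc_eq)
  then show ?case by blast
qed simp

text \<open>Subtracting from \<open>u\<close> its dual components gives a vector in the joint
  kernel, where \<open>g\<close> vanishes. This is the source of the Lagrange multipliers, with
  values \<open>g (w k)\<close>.\<close>

lemma functional_in_span:
  fixes f :: "nat \<Rightarrow> ('a \<Rightarrow> real) \<Rightarrow> real"
  assumes f: "\<And>k. k < l \<Longrightarrow> linear_functional (f k)" and g: "linear_functional g"
    and w: "\<And>k j. k < l \<Longrightarrow> j < l \<Longrightarrow> f k (w j) = (if k = j then 1 else 0)"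
    and ker: "\<And>u. (\<And>k. k < l \<Longrightarrow> f k u = 0) \<Longrightarrow> g u = 0"
  shows "g u = (\<Sum>k<l. g (w k) * f k u)"
proof -
  define z where "z = (\<lambda>x. u x + (\<Sum>j<l. - f j u * w j x))"
  have "f k z = 0" if "k < l" for k
  proof -
    have "(\<Sum>j<l. - f j u * f k (w j)) = (\<Sum>j<l. if k = j then - f j u else 0)"
      using that by (intro sum.cong) (auto simp: w)
    then show ?thesis unfolding z_def linear_functional_add_sum[OF f[OF that]] using that by simp
  qed
  then have "g z = 0" by (rule ker)
  then show ?thesis unfolding z_def linear_functional_add_sum[OF g]
    by (simp add: sum_negf mult.commute)
qed

section \<open>Fixed points and a perturbed quadratic system\<close>

text \<open>Banach iteration in the maximum norm over the coordinates below \<open>l\<close>,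
  started at the centre of the box; each coordinate converges by comparison with a geometric
  series.\<close>

lemma box_contraction_fixed_point:
  fixes G :: "(nat \<Rightarrow> real) \<Rightarrow> nat \<Rightarrow> real"
  assumes K: "0 \<le> K"
    and box: "\<And>v k. (\<forall>i<l. \<bar>v i\<bar> \<le> K) \<Longrightarrow> k < l \<Longrightarrow> \<bar>G v k\<bar> \<le> K"
    and contr: "\<And>u v d k. (\<forall>i<l. \<bar>u i\<bar> \<le> K) \<Longrightarrow> (\<forall>i<l. \<bar>v i\<bar> \<le> K) \<Longrightarrow>
      (\<forall>i<l. \<bar>u i - v i\<bar> \<le> d) \<Longrightarrow> k < l \<Longrightarrow> \<bar>G u k - G v k\<bar> \<le> d / 2"
  shows "\<exists>v. \<forall>k<l. \<bar>v k\<bar> \<le> K \<and> v k = G v k"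
proof -
  define w where "w = (\<lambda>n. (G ^^ n) (\<lambda>_. 0))"
  have w_Suc: "w (Suc n) = G (w n)" for n by (simp add: w_def)
  have wK: "\<forall>i<l. \<bar>w n i\<bar> \<le> K" for n
  proof (induction n)
    case 0 then show ?case using K by (simp add: w_def)
  next
    case (Suc n) then show ?case using box[OF Suc] by (simp add: w_Suc)
  qed
  have step: "\<forall>i<l. \<bar>w (Suc n) i - w n i\<bar> \<le> K * (1/2) ^ n" for n
  proof (induction n)
    case 0 then show ?case using wK[of "Suc 0"] by (simp add: w_def)
  next
    case (Suc n)
    then show ?case using contr[OF wK wK Suc] by (simp add: w_Suc)
  qed
  have "\<exists>L. (\<lambda>n. w n i) \<longlonglongrightarrow> L" if "i < l" for i
  proof -
    have "summable (\<lambda>n. K * (1/2::real) ^ n)" by (intro summable_mult summable_geometric) simp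
    then have "summable (\<lambda>n. w (Suc n) i - w n i)"
      by (rule summable_comparison_test') (use step that in auto)
    then have "convergent (\<lambda>n. \<Sum>j<n. w (Suc j) i - w j i)"
      by (simp add: summable_iff_convergent)
    moreover have "(\<lambda>n. \<Sum>j<n. w (Suc j) i - w j i) = (\<lambda>n. w n i)"
    proof
      fix n show "(\<Sum>j<n. w (Suc j) i - w j i) = w n i"
        using sum_lessThan_telescope[of "\<lambda>j. w j i" n] by (simp add: w_def)
    qed
    ultimately show ?thesis by (simp add: convergent_def)
  qed
  then obtain v where v: "\<And>i. i < l \<Longrightarrow> (\<lambda>n. w n i) \<longlonglongrightarrow> v i" by metis
  have vK: "\<forall>i<l. \<bar>v i\<bar> \<le> K"
  proof (intro allI impI)
    fix i assume i: "i < l"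
    have "(\<lambda>n. \<bar>w n i\<bar>) \<longlonglongrightarrow> \<bar>v i\<bar>" using v[OF i] by (rule tendsto_rabs)
    then show "\<bar>v i\<bar> \<le> K" by (rule LIMSEQ_le_const2) (use wK i in blast)
  qed
  have "v k = G v k" if k: "k < l" for k
  proof -
    \<comment> \<open>The sum of all coordinate distances dominates each of them and still tends to
      zero, so it is one admissible radius for the contraction hypothesis.\<close>
    define d where "d = (\<lambda>n. \<Sum>i<l. \<bar>w n i - v i\<bar>)"
    have "d \<longlonglongrightarrow> (\<Sum>i<l. \<bar>v i - v i\<bar>)"
      unfolding d_def using v by (intro tendsto_sum tendsto_rabs tendsto_diff) auto
    then have d0: "(\<lambda>n. d n / 2) \<longlonglongrightarrow> 0" using tendsto_divide[OF _ tendsto_const, of d 0 _ 2] by simp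
    have "\<bar>w n i - v i\<bar> \<le> d n" if "i < l" for n i
      unfolding d_def by (rule member_le_sum[of i "{..<l}" "\<lambda>i. \<bar>w n i - v i\<bar>"]) (use that in auto)
    then have "\<bar>G (w n) k - G v k\<bar> \<le> d n / 2" for n
      using contr[OF wK vK _ k] by blast
    then have "(\<lambda>n. \<bar>G (w n) k - G v k\<bar>) \<longlonglongrightarrow> 0"
      by (intro tendsto_sandwich[OF _ _ tendsto_const d0] always_eventually) auto
    then have "(\<lambda>n. G (w n) k - G v k) \<longlonglongrightarrow> 0" by (rule tendsto_rabs_zero_cancel)
    then have "(\<lambda>n. w (Suc n) k) \<longlonglongrightarrow> G v k"
      by (simp add: w_Suc LIM_zero_cancel)
    moreover have "(\<lambda>n. w (Suc n) k) \<longlonglongrightarrow> v k" using v[OF k] by (rule LIMSEQ_Suc)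
    ultimately show ?thesis using LIMSEQ_unique by blast
  qed
  then show ?thesis using vK by blast
qed

text \<open>At \<open>t = 0\<close> the right-hand side is the constant \<open>a\<close>, and for
  small \<open>t\<close> it is a contraction of a box around it. What matters later is that
  \<open>K\<close> is chosen before \<open>t\<close>.\<close>

lemma quadratic_system_solvable:
  fixes a :: "nat \<Rightarrow> real" and b :: "nat \<Rightarrow> nat \<Rightarrow> real" and c :: "nat \<Rightarrow> nat \<Rightarrow> nat \<Rightarrow> real"
  obtains K \<delta> where "0 < \<delta>" and "\<And>t. 0 < t \<Longrightarrow> t < \<delta> \<Longrightarrow> \<exists>v. \<forall>k<l. \<bar>v k\<bar> \<le> K \<and>
    v k = a k + t * (\<Sum>j<l. b k j * v j) + t\<^sup>2 * (\<Sum>i<l. \<Sum>j<l. c k i j * (v i * v j))"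
proof -
  define a' where "a' = (\<Sum>k<l. \<bar>a k\<bar>)"
  define b' where "b' = (\<Sum>k<l. \<Sum>j<l. \<bar>b k j\<bar>)"
  define c' where "c' = (\<Sum>k<l. \<Sum>i<l. \<Sum>j<l. \<bar>c k i j\<bar>)"
  have nn: "0 \<le> a'" "0 \<le> b'" "0 \<le> c'" unfolding a'_def b'_def c'_def by (auto intro!: sum_nonneg)
  have ak: "\<bar>a k\<bar> \<le> a'" if "k < l" for k
    unfolding a'_def by (rule member_le_sum[of k "{..<l}" "\<lambda>k. \<bar>a k\<bar>"]) (use that in auto)
  have bk: "(\<Sum>j<l. \<bar>b k j\<bar>) \<le> b'" if "k < l" for k
    unfolding b'_def by (rule member_le_sum[of k "{..<l}" "\<lambda>k. \<Sum>j<l. \<bar>b k j\<bar>"])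
      (use that in \<open>auto intro!: sum_nonneg\<close>)
  have ck: "(\<Sum>i<l. \<Sum>j<l. \<bar>c k i j\<bar>) \<le> c'" if "k < l" for k
    unfolding c'_def by (rule member_le_sum[of k "{..<l}" "\<lambda>k. \<Sum>i<l. \<Sum>j<l. \<bar>c k i j\<bar>"])
      (use that in \<open>auto intro!: sum_nonneg\<close>)
  have B: "\<bar>\<Sum>j<l. b k j * x j\<bar> \<le> b' * d" if "k < l" "\<forall>i<l. \<bar>x i\<bar> \<le> d" for k x d
  proof (cases "l = 0")
    case False
    then have d: "0 \<le> d" using that(2) by (metis abs_ge_zero order_trans not_gr0)
    have "\<bar>\<Sum>j<l. b k j * x j\<bar> \<le> (\<Sum>j<l. \<bar>b k j\<bar> * d)"
      by (rule order_trans[OF sum_abs]) (use that(2) in \<open>auto intro!: sum_mono mult_left_mono simp: abs_mult\<close>)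
    also have "\<dots> \<le> b' * d" using bk[OF that(1)] d by (simp add: sum_distrib_right[symmetric] mult_right_mono)
    finally show ?thesis .
  qed (use that in simp)
  have C: "\<bar>\<Sum>i<l. \<Sum>j<l. c k i j * x i j\<bar> \<le> c' * d" if "k < l" "\<forall>i<l. \<forall>j<l. \<bar>x i j\<bar> \<le> d" for k x d
  proof -
    have d: "0 \<le> d" using that by (meson abs_ge_zero order_trans)
    have "\<bar>\<Sum>i<l. \<Sum>j<l. c k i j * x i j\<bar> \<le> (\<Sum>i<l. \<Sum>j<l. \<bar>c k i j * x i j\<bar>)"
      by (rule order_trans[OF sum_abs]) (intro sum_mono sum_abs)
    also have "\<dots> \<le> (\<Sum>i<l. \<Sum>j<l. \<bar>c k i j\<bar> * d)"
      using that(2) by (auto intro!: sum_mono mult_left_mono simp: abs_mult)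
    also have "\<dots> \<le> c' * d" using ck[OF that(1)] d by (simp add: sum_distrib_right[symmetric] mult_right_mono)
    finally show ?thesis .
  qed
  \<comment> \<open>The box contains \<open>a\<close> with a margin of 1 for the terms carrying a
    factor \<open>t\<close>.\<close>
  define K where "K = a' + 1"
  have K: "1 \<le> K" using nn by (simp add: K_def)
  \<comment> \<open>Once \<open>t\<close> squared is bounded by \<open>t\<close>, the nonconstant
    part is at most \<open>t * (b' * K + c' * K\<^sup>2)\<close> on the box, with Lipschitz constant
    at most \<open>t * (b' + 2 * c' * K)\<close>. \<open>D\<close> dominates the first bracket and
    twice the second, so \<open>t * D \<le> 1\<close> gives both the invariance of the box and the
    contraction factor 1/2. The final 1 ensures \<open>t \<le> 1\<close>.\<close>
  define D where "D = b' * K + c' * K\<^sup>2 + 2 * (b' + 2 * c' * K) + 1"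
  have D: "1 \<le> D" using nn K by (simp add: D_def)
  have D1: "b' * K + c' * K\<^sup>2 \<le> D" and D2: "2 * (b' + 2 * c' * K) \<le> D"
    using nn K by (auto simp: D_def)
  show thesis
  proof (rule that[of "1 / D" K])
    show "0 < 1 / D" using D by simp
    fix t :: real assume t: "0 < t" "t < 1 / D"
    have tD: "t * D \<le> 1" using t D by (simp add: field_simps)
    have "1 / D \<le> 1" using D by simp
    then have t1: "t \<le> 1" using t by linarith
    have tt: "t\<^sup>2 \<le> t" using t t1 by (simp add: power2_eq_square)
    define G where "G = (\<lambda>v k. a k + t * (\<Sum>j<l. b k j * v j) + t\<^sup>2 * (\<Sum>i<l. \<Sum>j<l. c k i j * (v i * v j)))"
    have "\<exists>v. \<forall>k<l. \<bar>v k\<bar> \<le> K \<and> v k = G v k"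
    proof (rule box_contraction_fixed_point)
      show "0 \<le> K" using K by simp
    next
      fix v k assume v: "\<forall>i<l. \<bar>v i\<bar> \<le> K" and k: "k < l"
      have vv: "\<forall>i<l. \<forall>j<l. \<bar>v i * v j\<bar> \<le> K\<^sup>2"
        using v K by (auto simp: abs_mult power2_eq_square intro!: mult_mono)
      have "\<bar>G v k\<bar> \<le> \<bar>a k\<bar> + t * \<bar>\<Sum>j<l. b k j * v j\<bar> + t\<^sup>2 * \<bar>\<Sum>i<l. \<Sum>j<l. c k i j * (v i * v j)\<bar>"
        unfolding G_def using t by (intro order_trans[OF abs_triangle_ineq] add_mono) (auto simp: abs_mult)
      also have "\<dots> \<le> a' + t * (b' * K) + t * (c' * K\<^sup>2)"
        using ak[OF k] B[OF k v] C[OF k vv] t tt by (intro add_mono mult_mono) auto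
      also have "\<dots> = a' + t * (b' * K + c' * K\<^sup>2)" by (simp add: algebra_simps)
      also have "\<dots> \<le> a' + t * D" using D1 t by (intro add_left_mono mult_left_mono) auto
      finally show "\<bar>G v k\<bar> \<le> K" using tD by (simp add: K_def)
    next
      fix u v d k
      assume u: "\<forall>i<l. \<bar>u i\<bar> \<le> K" and v: "\<forall>i<l. \<bar>v i\<bar> \<le> K" and d: "\<forall>i<l. \<bar>u i - v i\<bar> \<le> d" and k: "k < l"
      have d0: "0 \<le> d" using d k by (meson abs_ge_zero order_trans)
      have uv: "\<forall>i<l. \<forall>j<l. \<bar>u i * u j - v i * v j\<bar> \<le> 2 * K * d"
      proof (intro allI impI)
        fix i j assume ij: "i < l" "j < l"
        have "u i * u j - v i * v j = u i * (u j - v j) + (u i - v i) * v j" by (simp add: algebra_simps)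
        then have "\<bar>u i * u j - v i * v j\<bar> \<le> \<bar>u i\<bar> * \<bar>u j - v j\<bar> + \<bar>u i - v i\<bar> * \<bar>v j\<bar>"
          by (metis abs_mult abs_triangle_ineq)
        also have "\<dots> \<le> K * d + d * K" using ij u v d d0 K by (intro add_mono mult_mono) auto
        finally show "\<bar>u i * u j - v i * v j\<bar> \<le> 2 * K * d" by simp
      qed
      have "G u k - G v k = t * (\<Sum>j<l. b k j * (u j - v j)) + t\<^sup>2 * (\<Sum>i<l. \<Sum>j<l. c k i j * (u i * u j - v i * v j))"
        by (simp add: G_def algebra_simps sum_subtractf)
      then have "\<bar>G u k - G v k\<bar> \<le> t * \<bar>\<Sum>j<l. b k j * (u j - v j)\<bar> + t\<^sup>2 * \<bar>\<Sum>i<l. \<Sum>j<l. c k i j * (u i * u j - v i * v j)\<bar>"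
        using t abs_triangle_ineq[of "t * (\<Sum>j<l. b k j * (u j - v j))"
            "t\<^sup>2 * (\<Sum>i<l. \<Sum>j<l. c k i j * (u i * u j - v i * v j))"]
        by (simp only: abs_mult abs_of_pos abs_power2)
      also have "\<dots> \<le> t * (b' * d) + t * (c' * (2 * K * d))"
        using B[OF k d] C[OF k uv] t tt by (intro add_mono mult_mono) auto
      also have "\<dots> = (t * (2 * (b' + 2 * c' * K))) * (d / 2)" by (simp add: field_simps)
      also have "\<dots> \<le> (t * D) * (d / 2)" using D2 t d0 by (intro mult_right_mono mult_left_mono) auto
      also have "\<dots> \<le> 1 * (d / 2)" using tD d0 by (intro mult_right_mono) auto
      finally show "\<bar>G u k - G v k\<bar> \<le> d / 2" by simp
    qed
    then show "\<exists>v. \<forall>k<l. \<bar>v k\<bar> \<le> K \<and>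
      v k = a k + t * (\<Sum>j<l. b k j * v j) + t\<^sup>2 * (\<Sum>i<l. \<Sum>j<l. c k i j * (v i * v j))"
      by (simp add: G_def)
  qed
qed

section \<open>Frobenius inner product and tangent cones\<close>

lemma mult_entry:
  assumes "A \<in> carrier_mat m p" "B \<in> carrier_mat p n" "i < m" "j < n"
  shows "(A * B) $$ (i,j) = (\<Sum>k<p. A $$ (i,k) * B $$ (k,j))"
  using assms by (simp add: scalar_prod_def atLeast0LessThan)

lemma frob_inner_carrier:
  "X \<in> carrier_mat m n \<Longrightarrow> frob_inner X Y = (\<Sum>i<m. \<Sum>j<n. X $$ (i,j) * Y $$ (i,j))"
  by (simp add: frob_inner_def)

lemma frob_inner_add_right:
  assumes "X \<in> carrier_mat m n" "Y \<in> carrier_mat m n" "Z \<in> carrier_mat m n"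
  shows "frob_inner X (Y + Z) = frob_inner X Y + frob_inner X Z"
  using assms by (simp add: frob_inner_carrier[of X m n] algebra_simps sum.distrib)

lemma frob_inner_add_left:
  assumes "X \<in> carrier_mat m n" "Y \<in> carrier_mat m n"
  shows "frob_inner (X + Y) Z = frob_inner X Z + frob_inner Y Z"
  using assms by (simp add: frob_inner_carrier[of _ m n] algebra_simps sum.distrib)

lemma frob_inner_minus_left:
  assumes "X \<in> carrier_mat m n" "Y \<in> carrier_mat m n"
  shows "frob_inner (X - Y) Z = frob_inner X Z - frob_inner Y Z"
  unfolding frob_inner_carrier[OF minus_carrier_mat[OF assms(2), of X]]
    frob_inner_carrier[OF assms(1)] frob_inner_carrier[OF assms(2)]
  using assms by (simp add: algebra_simps sum_subtractf)

lemma frob_inner_minus_right: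
  assumes "X \<in> carrier_mat m n" "Y \<in> carrier_mat m n" "Z \<in> carrier_mat m n"
  shows "frob_inner X (Y - Z) = frob_inner X Y - frob_inner X Z"
  using assms by (simp add: frob_inner_carrier[of X m n] algebra_simps sum_subtractf)

lemma frob_inner_smult_right:
  assumes "X \<in> carrier_mat m n" "Y \<in> carrier_mat m n"
  shows "frob_inner X (c \<cdot>\<^sub>m Y) = c * frob_inner X Y"
  using assms by (simp add: frob_inner_carrier[of X m n] sum_distrib_left mult.left_commute)

text \<open>Multiplication by \<open>Q\<close> and by its transpose are adjoint. With the mirror
  statement for left factors, this turns orthogonality to all products into a matrix
  equation.\<close>

lemma frob_inner_mult_right:
  assumes Y: "Y \<in> carrier_mat m n" and P: "P \<in> carrier_mat m p" and Q: "Q \<in> carrier_mat p n"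
  shows "frob_inner Y (P * Q) = frob_inner (Y * transpose_mat Q) P"
proof -
  have QT: "transpose_mat Q \<in> carrier_mat n p" using Q by simp
  have "frob_inner Y (P * Q) = (\<Sum>i<m. \<Sum>j<n. \<Sum>k<p. Y $$ (i,j) * (P $$ (i,k) * Q $$ (k,j)))"
    unfolding frob_inner_carrier[OF Y]
    by (intro sum.cong refl) (simp add: mult_entry[OF P Q] sum_distrib_left)
  also have "\<dots> = (\<Sum>i<m. \<Sum>k<p. \<Sum>j<n. Y $$ (i,j) * (P $$ (i,k) * Q $$ (k,j)))"
    by (intro sum.cong refl sum.swap)
  also have "\<dots> = frob_inner (Y * transpose_mat Q) P"
    unfolding frob_inner_carrier[OF mult_carrier_mat[OF Y QT]]
    using Q by (intro sum.cong refl) (simp add: mult_entry[OF Y QT] sum_distrib_left mult_ac)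
  finally show ?thesis .
qed

lemma frob_inner_mult_left:
  assumes Y: "Y \<in> carrier_mat m n" and P: "P \<in> carrier_mat m p" and Q: "Q \<in> carrier_mat p n"
  shows "frob_inner Y (P * Q) = frob_inner (transpose_mat P * Y) Q"
proof -
  have PT: "transpose_mat P \<in> carrier_mat p m" using P by simp
  have "frob_inner Y (P * Q) = (\<Sum>i<m. \<Sum>j<n. \<Sum>k<p. Y $$ (i,j) * (P $$ (i,k) * Q $$ (k,j)))"
    unfolding frob_inner_carrier[OF Y]
    by (intro sum.cong refl) (simp add: mult_entry[OF P Q] sum_distrib_left)
  also have "\<dots> = (\<Sum>i<m. \<Sum>k<p. \<Sum>j<n. Y $$ (i,j) * (P $$ (i,k) * Q $$ (k,j)))"
    by (intro sum.cong refl sum.swap)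
  also have "\<dots> = (\<Sum>k<p. \<Sum>i<m. \<Sum>j<n. Y $$ (i,j) * (P $$ (i,k) * Q $$ (k,j)))"
    by (rule sum.swap)
  also have "\<dots> = (\<Sum>k<p. \<Sum>j<n. \<Sum>i<m. Y $$ (i,j) * (P $$ (i,k) * Q $$ (k,j)))"
    by (intro sum.cong refl sum.swap)
  also have "\<dots> = frob_inner (transpose_mat P * Y) Q"
    unfolding frob_inner_carrier[OF mult_carrier_mat[OF PT Y]]
    using P by (intro sum.cong refl) (simp add: mult_entry[OF PT Y] sum_distrib_left mult_ac)
  finally show ?thesis .
qed

lemma frob_inner_self_nonneg: "0 \<le> frob_inner X X"
  unfolding frob_inner_def by (intro sum_nonneg) simp

lemma frob_inner_self_eq_0:
  assumes X: "X \<in> carrier_mat m n" and "frob_inner X X = 0"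
  shows "X = 0\<^sub>m m n"
proof (rule eq_matI)
  fix i j assume "i < dim_row (0\<^sub>m m n :: real mat)" "j < dim_col (0\<^sub>m m n :: real mat)"
  then have ij: "i < m" "j < n" by auto
  have "(\<Sum>i<m. \<Sum>j<n. X $$ (i,j) * X $$ (i,j)) = 0"
    using assms(2) frob_inner_carrier[OF X] by simp
  then have "(\<Sum>j<n. X $$ (i,j) * X $$ (i,j)) = 0"
    using ij by (subst (asm) sum_nonneg_eq_0_iff) (auto intro!: sum_nonneg)
  then show "X $$ (i,j) = 0\<^sub>m m n $$ (i,j)"
    using ij by (subst (asm) sum_nonneg_eq_0_iff) auto
qed (use X in auto)

text \<open>The adjoint of the constraint map, evaluated at the multiplier vector
  \<open>y\<close>.\<close>

definition mat_comb :: "nat \<Rightarrow> nat \<Rightarrow> nat \<Rightarrow> (nat \<Rightarrow> real mat) \<Rightarrow> (nat \<Rightarrow> real) \<Rightarrow> real mat" where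
  "mat_comb m n l A y = mat m n (\<lambda>(p,q). \<Sum>i<l. y i * A i $$ (p,q))"

lemma mat_comb_carrier [simp]: "mat_comb m n l A y \<in> carrier_mat m n"
  by (simp add: mat_comb_def)

lemma normL_eq_range: "normL m n l A = range (mat_comb m n l A)"
  by (auto simp: normL_def mat_comb_def)

lemma frob_inner_mat_comb:
  assumes A: "\<forall>i<l. A i \<in> carrier_mat m n"
  shows "frob_inner (mat_comb m n l A y) Z = (\<Sum>k<l. y k * frob_inner (A k) Z)"
proof -
  have "frob_inner (mat_comb m n l A y) Z = (\<Sum>i<m. \<Sum>j<n. \<Sum>k<l. y k * A k $$ (i,j) * Z $$ (i,j))"
    unfolding frob_inner_carrier[OF mat_comb_carrier]
    by (intro sum.cong refl) (simp add: mat_comb_def sum_distrib_right)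
  also have "\<dots> = (\<Sum>i<m. \<Sum>k<l. \<Sum>j<n. y k * A k $$ (i,j) * Z $$ (i,j))"
    by (intro sum.cong refl sum.swap)
  also have "\<dots> = (\<Sum>k<l. \<Sum>i<m. \<Sum>j<n. y k * A k $$ (i,j) * Z $$ (i,j))"
    by (rule sum.swap)
  also have "\<dots> = (\<Sum>k<l. y k * frob_inner (A k) Z)"
    using A by (intro sum.cong refl) (simp add: frob_inner_carrier[of _ m n] sum_distrib_left mult.assoc)
  finally show ?thesis .
qed

section \<open>Tangent and normal cones\<close>

lemma frob_inner_tendsto:
  assumes "Y \<in> carrier_mat m n" and "mat_tendsto m n Zs Z"
  shows "(\<lambda>k. frob_inner Y (Zs k)) \<longlonglongrightarrow> frob_inner Y Z"
  unfolding frob_inner_carrier[OF assms(1)] using assms(2)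
  by (intro tendsto_sum tendsto_mult tendsto_const) (auto simp: mat_tendsto_def)

text \<open>Convergence of the difference quotients already forces the points to converge to
  \<open>X\<close>, since they equal \<open>X\<close> plus \<open>t\<close> times the
  quotient.\<close>

lemma bouligand_tangentI:
  assumes X: "X \<in> carrier_mat m n" and \<Xi>: "\<Xi> \<in> carrier_mat m n" and \<Omega>: "\<Omega> \<subseteq> carrier_mat m n"
    and Xs: "\<And>k. Xs k \<in> \<Omega>" and t: "\<And>k. t k > 0" "t \<longlonglongrightarrow> 0"
    and lim: "\<And>i j. i < m \<Longrightarrow> j < n \<Longrightarrow> (\<lambda>k. (Xs k $$ (i,j) - X $$ (i,j)) / t k) \<longlonglongrightarrow> \<Xi> $$ (i,j)"
  shows "\<Xi> \<in> bouligand_tangent m n \<Omega> X"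
proof -
  have c: "Xs k \<in> carrier_mat m n" for k using Xs \<Omega> by blast
  have "mat_tendsto m n Xs X" unfolding mat_tendsto_def
  proof (intro allI impI)
    fix i j assume ij: "i < m" "j < n"
    have "(\<lambda>k. X $$ (i,j) + t k * ((Xs k $$ (i,j) - X $$ (i,j)) / t k)) \<longlonglongrightarrow> X $$ (i,j) + 0 * \<Xi> $$ (i,j)"
      by (intro tendsto_intros t(2) lim ij)
    moreover have "X $$ (i,j) + t k * ((Xs k $$ (i,j) - X $$ (i,j)) / t k) = Xs k $$ (i,j)" for k
      using t(1)[of k] by simp
    ultimately show "(\<lambda>k. Xs k $$ (i,j)) \<longlonglongrightarrow> X $$ (i,j)" by simp
  qed
  moreover have "mat_tendsto m n (\<lambda>k. (1 / t k) \<cdot>\<^sub>m (Xs k - X)) \<Xi>" unfolding mat_tendsto_def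
  proof (intro allI impI)
    fix i j assume ij: "i < m" "j < n"
    have "((1 / t k) \<cdot>\<^sub>m (Xs k - X)) $$ (i,j) = (Xs k $$ (i,j) - X $$ (i,j)) / t k" for k
      using ij X c[of k] by simp
    then show "(\<lambda>k. ((1 / t k) \<cdot>\<^sub>m (Xs k - X)) $$ (i,j)) \<longlonglongrightarrow> \<Xi> $$ (i,j)"
      using lim[OF ij] by simp
  qed
  ultimately show ?thesis unfolding bouligand_tangent_def using \<Xi> Xs t by blast
qed

lemma bouligand_tangent_mono:
  "\<Omega> \<subseteq> \<Omega>' \<Longrightarrow> bouligand_tangent m n \<Omega> X \<subseteq> bouligand_tangent m n \<Omega>' X"
  unfolding bouligand_tangent_def by blast

text \<open>Every difference quotient of feasible points is exactly orthogonal to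
  \<open>A k\<close>, and orthogonality passes to the limit.\<close>

lemma bouligand_tangent_affL_orth:
  assumes A: "\<forall>i<l. A i \<in> carrier_mat m n" and X: "X \<in> affL m n l A b"
    and \<Xi>: "\<Xi> \<in> bouligand_tangent m n (affL m n l A b) X" and k: "k < l"
  shows "frob_inner (A k) \<Xi> = 0"
proof -
  obtain Xs and t :: "nat \<Rightarrow> real" where *: "\<And>i. Xs i \<in> affL m n l A b"
    "mat_tendsto m n (\<lambda>k. (1 / t k) \<cdot>\<^sub>m (Xs k - X)) \<Xi>"
    using \<Xi> unfolding bouligand_tangent_def by blast
  have Ak: "A k \<in> carrier_mat m n" using A k by blast
  have "frob_inner (A k) ((1 / t i) \<cdot>\<^sub>m (Xs i - X)) = 0" for i
  proof -
    have c: "Xs i \<in> carrier_mat m n" "X \<in> carrier_mat m n" using *(1)[of i] X by (auto simp: affL_def)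
    then have "frob_inner (A k) ((1 / t i) \<cdot>\<^sub>m (Xs i - X)) = (1 / t i) * (frob_inner (A k) (Xs i) - frob_inner (A k) X)"
      using frob_inner_smult_right[OF Ak minus_carrier_mat[OF c(2)]] frob_inner_minus_right[OF Ak c] by metis
    then show ?thesis using *(1)[of i] X k by (simp add: affL_def)
  qed
  then show ?thesis
    using frob_inner_tendsto[OF Ak *(2)] by (simp add: LIMSEQ_const_iff)
qed

text \<open>A tangent to the intersection is tangent to both sets: it is orthogonal to the
  combination of the \<open>A k\<close> and has nonpositive product with the other summand.\<close>

lemma normal_sum_subset:
  assumes A: "\<forall>i<l. A i \<in> carrier_mat m n" and X: "X \<in> affL m n l A b"
  shows "mset_plus (normL m n l A) (frechet_normal m n \<Omega> X)
    \<subseteq> frechet_normal m n (affL m n l A b \<inter> \<Omega>) X"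
proof
  fix Y assume "Y \<in> mset_plus (normL m n l A) (frechet_normal m n \<Omega> X)"
  then obtain y Z where Y: "Y = mat_comb m n l A y + Z" and Z: "Z \<in> frechet_normal m n \<Omega> X"
    by (auto simp: mset_plus_def normL_eq_range)
  have Zc: "Z \<in> carrier_mat m n" using Z by (simp add: frechet_normal_def)
  have "frob_inner Y \<Xi> \<le> 0" if "\<Xi> \<in> bouligand_tangent m n (affL m n l A b \<inter> \<Omega>) X" for \<Xi>
  proof -
    have 1: "\<Xi> \<in> bouligand_tangent m n (affL m n l A b) X" and 2: "\<Xi> \<in> bouligand_tangent m n \<Omega> X"
      using that bouligand_tangent_mono[of "affL m n l A b \<inter> \<Omega>"] by blast+
    have "frob_inner (mat_comb m n l A y) \<Xi> = 0"
      using bouligand_tangent_affL_orth[OF A X 1] by (simp add: frob_inner_mat_comb[OF A])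
    moreover have "frob_inner Z \<Xi> \<le> 0" using Z 2 by (simp add: frechet_normal_def)
    ultimately show ?thesis by (simp add: Y frob_inner_add_left[OF mat_comb_carrier Zc])
  qed
  then show "Y \<in> frechet_normal m n (affL m n l A b \<inter> \<Omega>) X"
    using Zc by (simp add: frechet_normal_def Y)
qed

lemma det_tendsto:
  fixes Ns :: "nat \<Rightarrow> real mat"
  assumes Ns: "\<And>k. Ns k \<in> carrier_mat p p" and N: "N \<in> carrier_mat p p"
    and lim: "\<And>i j. i < p \<Longrightarrow> j < p \<Longrightarrow> (\<lambda>k. Ns k $$ (i,j)) \<longlonglongrightarrow> N $$ (i,j)"
  shows "(\<lambda>k. det (Ns k)) \<longlonglongrightarrow> det N"
  unfolding det_def'[OF Ns] det_def'[OF N]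
  by (intro tendsto_sum tendsto_mult tendsto_const tendsto_prod lim) (auto simp: permutes_in_image)

section \<open>Coordinates given by a singular value decomposition\<close>

locale svd_point =
  fixes m n s :: nat and X U \<Sigma> V :: "real mat"
  assumes n_le_m: "n \<le> m" and s_less_n: "s < n" and svd: "is_svd m n X s U \<Sigma> V"
begin

text \<open>\<open>Y\<close> in the singular bases, an isometric change of coordinates.
  \<open>R_mat\<close> and the three nonzero blocks of \<open>T_mat\<close> are submatrices of this
  matrix, so both assumptions become statements about its entries.\<close>

definition coords :: "real mat \<Rightarrow> real mat" where
  "coords Y = transpose_mat U * Y * V"

definition P :: "real mat" where
  "P = mat m s (\<lambda>(i,j). U $$ (i,j) * \<Sigma> $$ (j,j))"

definition Q :: "real mat" where
  "Q = transpose_mat (col_sub V 0 s)"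

lemma U_carrier [simp]: "U \<in> carrier_mat m m" and V_carrier [simp]: "V \<in> carrier_mat n n"
  and \<Sigma>_carrier [simp]: "\<Sigma> \<in> carrier_mat m n"
  and U_orth: "transpose_mat U * U = 1\<^sub>m m" and V_orth: "transpose_mat V * V = 1\<^sub>m n"
  and X_svd: "X = U * \<Sigma> * transpose_mat V"
  using svd by (auto simp: is_svd_def)

lemma UT_carrier [simp]: "transpose_mat U \<in> carrier_mat m m"
  and VT_carrier [simp]: "transpose_mat V \<in> carrier_mat n n"
  by simp_all

lemma X_carrier [simp]: "X \<in> carrier_mat m n"
  unfolding X_svd by (rule mult_carrier_mat[OF mult_carrier_mat[OF U_carrier \<Sigma>_carrier] VT_carrier])

lemma P_carrier [simp]: "P \<in> carrier_mat m s" by (simp add: P_def)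

lemma Q_carrier [simp]: "Q \<in> carrier_mat s n"
  by (rule carrier_matI) (use carrier_matD[OF V_carrier] in \<open>simp_all add: Q_def col_sub_def\<close>)

lemma dims [simp]:
  "dim_row U = m" "dim_col U = m" "dim_row V = n" "dim_col V = n" "dim_row X = m" "dim_col X = n"
  "dim_row P = m" "dim_col P = s" "dim_row Q = s" "dim_col Q = n"
  using carrier_matD[OF U_carrier] carrier_matD[OF V_carrier] carrier_matD[OF X_carrier]
    carrier_matD[OF P_carrier] carrier_matD[OF Q_carrier] by simp_all

lemma Q_entry: "k < s \<Longrightarrow> j < n \<Longrightarrow> Q $$ (k,j) = V $$ (j,k)"
  by (simp add: Q_def col_sub_def)

lemma \<Sigma>_pos: "i < s \<Longrightarrow> \<Sigma> $$ (i,i) > 0"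
  using svd by (auto simp: is_svd_def)

lemma \<Sigma>_zero: "i < m \<Longrightarrow> j < n \<Longrightarrow> i \<noteq> j \<or> s \<le> i \<Longrightarrow> \<Sigma> $$ (i,j) = 0"
  using svd by (cases "i = j") (auto simp: is_svd_def)

lemma U_orth': "U * transpose_mat U = 1\<^sub>m m"
  using mat_mult_left_right_inverse[OF UT_carrier U_carrier U_orth] .

lemma V_orth': "V * transpose_mat V = 1\<^sub>m n"
  using mat_mult_left_right_inverse[OF VT_carrier V_carrier V_orth] .

lemma coords_carrier: "Y \<in> carrier_mat m n \<Longrightarrow> coords Y \<in> carrier_mat m n"
  unfolding coords_def by (rule mult_carrier_mat[OF mult_carrier_mat[OF UT_carrier] V_carrier])

lemma coords_entry:
  assumes Y: "Y \<in> carrier_mat m n" and ij: "i < m" "j < n"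
  shows "coords Y $$ (i,j) = (\<Sum>b<n. (\<Sum>a<m. U $$ (a,i) * Y $$ (a,b)) * V $$ (b,j))"
  unfolding coords_def
  using ij
  by (subst mult_entry[OF mult_carrier_mat[OF UT_carrier Y] V_carrier ij], intro sum.cong refl)
    (simp add: mult_entry[OF UT_carrier Y])

lemma coords_entry':
  assumes Y: "Y \<in> carrier_mat m n" and ij: "i < m" "j < n"
  shows "coords Y $$ (i,j) = (\<Sum>a<m. U $$ (a,i) * (\<Sum>b<n. Y $$ (a,b) * V $$ (b,j)))"
proof -
  have "coords Y = transpose_mat U * (Y * V)"
    unfolding coords_def by (rule assoc_mult_mat[OF UT_carrier Y V_carrier])
  then show ?thesis
    using ij
    by (simp only: mult_entry[OF UT_carrier mult_carrier_mat[OF Y V_carrier] ij])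
      (intro sum.cong refl, simp add: mult_entry[OF Y V_carrier])
qed

lemma coords_recover:
  assumes Y: "Y \<in> carrier_mat m n"
  shows "Y = U * (coords Y * transpose_mat V)"
proof -
  have "coords Y * transpose_mat V = transpose_mat U * Y * (V * transpose_mat V)"
    unfolding coords_def
    by (rule assoc_mult_mat[OF mult_carrier_mat[OF UT_carrier Y] V_carrier VT_carrier])
  also have "\<dots> = transpose_mat U * Y"
    unfolding V_orth' by (rule right_mult_one_mat[OF mult_carrier_mat[OF UT_carrier Y]])
  finally have "U * (coords Y * transpose_mat V) = U * transpose_mat U * Y"
    using assoc_mult_mat[OF U_carrier UT_carrier Y] by simp
  then show ?thesis unfolding U_orth' using left_mult_one_mat[OF Y] by simp
qed

lemma frob_inner_coords:
  assumes Y: "Y \<in> carrier_mat m n" and Z: "Z \<in> carrier_mat m n"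
  shows "frob_inner Y Z = frob_inner (coords Y) (coords Z)"
proof -
  have ZV: "coords Z * transpose_mat V \<in> carrier_mat m n"
    using coords_carrier[OF Z] by (rule mult_carrier_mat) simp
  have "frob_inner Y Z = frob_inner Y (U * (coords Z * transpose_mat V))"
    using coords_recover[OF Z] by simp
  also have "\<dots> = frob_inner (transpose_mat U * Y) (coords Z * transpose_mat V)"
    by (rule frob_inner_mult_left[OF Y U_carrier ZV])
  also have "\<dots> = frob_inner (transpose_mat U * Y * transpose_mat (transpose_mat V)) (coords Z)"
    by (rule frob_inner_mult_right[OF mult_carrier_mat[OF UT_carrier Y] coords_carrier[OF Z] VT_carrier])
  finally show ?thesis by (simp add: coords_def)
qed

lemma coords_X: "coords X = \<Sigma>"
proof -
  have "transpose_mat U * X = transpose_mat U * (U * (\<Sigma> * transpose_mat V))"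
    unfolding X_svd using assoc_mult_mat[OF U_carrier \<Sigma>_carrier VT_carrier] by simp
  also have "\<dots> = (transpose_mat U * U) * (\<Sigma> * transpose_mat V)"
    by (rule assoc_mult_mat[OF UT_carrier U_carrier mult_carrier_mat[OF \<Sigma>_carrier VT_carrier], symmetric])
  also have "\<dots> = \<Sigma> * transpose_mat V"
    unfolding U_orth by (rule left_mult_one_mat[OF mult_carrier_mat[OF \<Sigma>_carrier VT_carrier]])
  finally have "coords X = \<Sigma> * (transpose_mat V * V)"
    unfolding coords_def using assoc_mult_mat[OF \<Sigma>_carrier VT_carrier V_carrier] by simp
  then show ?thesis unfolding V_orth using right_mult_one_mat[OF \<Sigma>_carrier] by simp
qed

lemma X_factorization: "X = P * Q"
proof (rule eq_matI)
  fix i j assume "i < dim_row (P * Q)" "j < dim_col (P * Q)"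
  then have ij: "i < m" "j < n" using P_carrier Q_carrier by auto
  have "X $$ (i,j) = (\<Sum>k<n. (\<Sum>a<m. U $$ (i,a) * \<Sigma> $$ (a,k)) * V $$ (j,k))"
    unfolding X_svd using ij V_carrier
    by (subst mult_entry[OF mult_carrier_mat[OF U_carrier \<Sigma>_carrier] VT_carrier ij], intro sum.cong refl)
      (simp add: mult_entry[OF U_carrier \<Sigma>_carrier])
  also have "\<dots> = (\<Sum>k<n. if k < s then U $$ (i,k) * \<Sigma> $$ (k,k) * V $$ (j,k) else 0)"
  proof (intro sum.cong refl)
    fix k assume "k \<in> {..<n}"
    then have k: "k < n" "k < m" using n_le_m by auto
    have "(\<Sum>a<m. U $$ (i,a) * \<Sigma> $$ (a,k)) = (\<Sum>a<m. if a = k then U $$ (i,k) * \<Sigma> $$ (k,k) else 0)"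
      using k by (intro sum.cong refl) (auto simp: \<Sigma>_zero)
    also have "\<dots> = U $$ (i,k) * \<Sigma> $$ (k,k)" using k by simp
    finally show "(\<Sum>a<m. U $$ (i,a) * \<Sigma> $$ (a,k)) * V $$ (j,k) =
      (if k < s then U $$ (i,k) * \<Sigma> $$ (k,k) * V $$ (j,k) else 0)"
      using \<Sigma>_zero[of k k] k by auto
  qed
  also have "\<dots> = (\<Sum>k<s. U $$ (i,k) * \<Sigma> $$ (k,k) * V $$ (j,k))"
  proof -
    have "{..<n} \<inter> {k. k < s} = {..<s}" using s_less_n by auto
    then show ?thesis by (simp add: sum.If_cases)
  qed
  also have "\<dots> = (P * Q) $$ (i,j)"
    using ij by (subst mult_entry[OF P_carrier Q_carrier ij], intro sum.cong refl)
      (simp add: P_def Q_entry)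
  finally show "X $$ (i,j) = (P * Q) $$ (i,j)" .
qed (use X_carrier P_carrier Q_carrier in auto)

lemma coords_zero_right:
  assumes Y: "Y \<in> carrier_mat m n" and 0: "Y * transpose_mat Q = 0\<^sub>m m s" and ij: "i < m" "j < s"
  shows "coords Y $$ (i,j) = 0"
proof -
  have QT: "transpose_mat Q \<in> carrier_mat n s" by simp
  have jn: "j < n" using ij s_less_n by simp
  have "(\<Sum>b<n. Y $$ (a,b) * V $$ (b,j)) = 0" if "a < m" for a
  proof -
    have "(\<Sum>b<n. Y $$ (a,b) * V $$ (b,j)) = (Y * transpose_mat Q) $$ (a,j)"
      using that ij Q_carrier
      by (subst mult_entry[OF Y QT]) (auto intro!: sum.cong simp: Q_entry)
    then show ?thesis using 0 that ij by simp
  qed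
  then show ?thesis by (simp add: coords_entry'[OF Y ij(1) jn])
qed

text \<open>Column \<open>i\<close> of \<open>P\<close> is the left singular vector scaled by
  \<open>\<Sigma> $$ (i,i)\<close>, a positive number that can be cancelled.\<close>

lemma coords_zero_left:
  assumes Y: "Y \<in> carrier_mat m n" and 0: "transpose_mat P * Y = 0\<^sub>m s n" and ij: "i < s" "j < n"
  shows "coords Y $$ (i,j) = 0"
proof -
  have PT: "transpose_mat P \<in> carrier_mat s m" by simp
  have im: "i < m" using ij s_less_n n_le_m by simp
  have "(\<Sum>a<m. U $$ (a,i) * Y $$ (a,b)) = 0" if "b < n" for b
  proof -
    have "\<Sigma> $$ (i,i) * (\<Sum>a<m. U $$ (a,i) * Y $$ (a,b)) = (transpose_mat P * Y) $$ (i,b)"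
      using that ij P_carrier
      by (subst mult_entry[OF PT Y]) (auto intro!: sum.cong simp: P_def sum_distrib_left)
    then have "\<Sigma> $$ (i,i) * (\<Sum>a<m. U $$ (a,i) * Y $$ (a,b)) = 0" using 0 that ij by simp
    then show ?thesis using \<Sigma>_pos[OF ij(1)] by simp
  qed
  then show ?thesis by (simp add: coords_entry[OF Y im ij(2)])
qed

text \<open>Each coordinate is the inner product with the rank-one matrix formed by a left and a
  right singular vector, so linearity of \<open>coords\<close> is inherited from
  \<open>frob_inner\<close>.\<close>

lemma coords_eq_frob_inner:
  assumes Y: "Y \<in> carrier_mat m n" and ij: "i < m" "j < n"
  shows "coords Y $$ (i,j) = frob_inner Y (mat m n (\<lambda>(a,b). U $$ (a,i) * V $$ (b,j)))"
  unfolding coords_entry'[OF assms] frob_inner_carrier[OF Y]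
  by (intro sum.cong refl) (simp add: sum_distrib_left mult.left_commute)

lemma coords_mat_comb:
  assumes A: "\<forall>k<l. A k \<in> carrier_mat m n" and ij: "i < m" "j < n"
  shows "coords (mat_comb m n l A y) $$ (i,j) = (\<Sum>k<l. y k * coords (A k) $$ (i,j))"
  unfolding coords_eq_frob_inner[OF mat_comb_carrier ij] frob_inner_mat_comb[OF A]
  by (intro sum.cong refl) (simp add: coords_eq_frob_inner[OF _ ij] A)

lemma coords_smult_diff:
  assumes Y: "Y \<in> carrier_mat m n" and Z: "Z \<in> carrier_mat m n" and ij: "i < m" "j < n"
  shows "coords (c \<cdot>\<^sub>m (Y - Z)) $$ (i,j) = c * (coords Y $$ (i,j) - coords Z $$ (i,j))"
proof -
  define E where "E = mat m n (\<lambda>(a,b). U $$ (a,i) * V $$ (b,j))"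
  have c: "c \<cdot>\<^sub>m (Y - Z) \<in> carrier_mat m n" using minus_carrier_mat[OF Z, of Y] by simp
  have "frob_inner (c \<cdot>\<^sub>m (Y - Z)) E = (\<Sum>a<m. \<Sum>b<n. c * (Y $$ (a,b) * E $$ (a,b) - Z $$ (a,b) * E $$ (a,b)))"
    unfolding frob_inner_carrier[OF c] using Y Z
    by (intro sum.cong refl) (simp add: algebra_simps)
  also have "\<dots> = c * frob_inner (Y - Z) E"
    unfolding frob_inner_minus_left[OF Y Z] frob_inner_carrier[OF Y] frob_inner_carrier[OF Z]
    by (simp only: sum_distrib_left[symmetric] sum_subtractf)
  finally show ?thesis
    unfolding coords_eq_frob_inner[OF c ij] coords_eq_frob_inner[OF Y ij] coords_eq_frob_inner[OF Z ij]
    by (simp add: E_def frob_inner_minus_left[OF Y Z])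
qed

text \<open>The offsets \<open>a0\<close> and \<open>b0\<close> let one computation cover all blocks
  of \<open>T_mat\<close> and \<open>R_mat\<close>.\<close>

lemma block_entry:
  assumes Y: "Y \<in> carrier_mat m n"
    and a: "a0 + i < m" "i < a1 - a0" "a1 \<le> m" and b: "b0 + j < n" "j < b1 - b0" "b1 \<le> n"
  shows "(transpose_mat (col_sub U a0 a1) * Y * col_sub V b0 b1) $$ (i,j) = coords Y $$ (a0 + i, b0 + j)"
proof -
  have Uc: "transpose_mat (col_sub U a0 a1) \<in> carrier_mat (a1 - a0) m"
    by (simp add: col_sub_def)
  have Vc: "col_sub V b0 b1 \<in> carrier_mat n (b1 - b0)"
    by (simp add: col_sub_def)
  have "(transpose_mat (col_sub U a0 a1) * Y) $$ (i,q) = (\<Sum>p<m. U $$ (p, a0 + i) * Y $$ (p,q))"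
    if "q < n" for q
    using a that by (simp add: mult_entry[OF Uc Y]) (simp add: col_sub_def)
  then have "(transpose_mat (col_sub U a0 a1) * Y * col_sub V b0 b1) $$ (i,j)
    = (\<Sum>q<n. (\<Sum>p<m. U $$ (p, a0 + i) * Y $$ (p,q)) * V $$ (q, b0 + j))"
    unfolding mult_entry[OF mult_carrier_mat[OF Uc Y] Vc a(2) b(2)]
    using b by (intro sum.cong refl) (simp add: col_sub_def)
  then show ?thesis by (simp add: coords_entry[OF Y a(1) b(1)])
qed

lemma R_mat_entry:
  assumes Y: "Y \<in> carrier_mat m n" and ij: "i < m" "j < s"
  shows "R_mat s U V Y $$ (i,j) = coords Y $$ (i,j)"
proof -
  have "col_sub U 0 m = U" by (auto simp: col_sub_def)
  then show ?thesis
    using block_entry[OF Y, of 0 i m 0 j s] ij s_less_n by (simp add: R_mat_def)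
qed

lemma T_mat_entry:
  assumes Y: "Y \<in> carrier_mat m n" and ij: "i < m" "j < n"
  shows "T_mat m n s U V Y $$ (i,j) = (if i < s \<or> j < s then coords Y $$ (i,j) else 0)"
proof -
  have d: "dim_row (col_sub U a0 a1) = m" "dim_col (col_sub U a0 a1) = a1 - a0"
    "dim_row (col_sub V a0 a1) = n" "dim_col (col_sub V a0 a1) = a1 - a0" for a0 a1
    by (auto simp: col_sub_def)
  show ?thesis
    using ij s_less_n n_le_m block_entry[OF Y, of 0 i s 0 j s] block_entry[OF Y, of 0 i s s "j - s" n]
      block_entry[OF Y, of s "i - s" m 0 j s]
    by (auto simp: T_mat_def d)
qed

text \<open>Bordering the invertible block \<open>\<Sigma>\<^sub>\<Gamma>\<close> by row \<open>i\<close>, rescaled by \<open>1 / t\<close>, and column \<open>j\<close>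
  gives minors that vanish along the sequence and converge to \<open>det \<Sigma>\<^sub>\<Gamma>\<close> times the entry \<open>(i, j)\<close>.\<close>

lemma tangent_lowrank_coords_zero:
  assumes \<Xi>: "\<Xi> \<in> bouligand_tangent m n (lowrank m n s) X" and ij: "s \<le> i" "i < m" "s \<le> j" "j < n"
  shows "coords \<Xi> $$ (i,j) = 0"
proof -
  obtain Xs and t :: "nat \<Rightarrow> real" where Xs: "\<And>k. Xs k \<in> lowrank m n s" "mat_tendsto m n Xs X"
    and t: "\<And>k. t k > 0" and lim: "mat_tendsto m n (\<lambda>k. (1 / t k) \<cdot>\<^sub>m (Xs k - X)) \<Xi>"
    and \<Xi>c: "\<Xi> \<in> carrier_mat m n"
    using \<Xi> unfolding bouligand_tangent_def by blast
  have Xc: "Xs k \<in> carrier_mat m n" and Xr: "mrank (Xs k) < Suc s" for k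
    using Xs(1)[of k] by (auto simp: lowrank_def)
  have Dc: "(1 / t k) \<cdot>\<^sub>m (Xs k - X) \<in> carrier_mat m n" for k
    using minus_carrier_mat[OF X_carrier, of "Xs k"] by simp
  have clim: "(\<lambda>k. coords (Zs k) $$ (a,b)) \<longlonglongrightarrow> coords Z $$ (a,b)"
    if "a < m" "b < n" "mat_tendsto m n Zs Z" "\<And>k. Zs k \<in> carrier_mat m n" "Z \<in> carrier_mat m n" for Zs Z a b
    using that unfolding mat_tendsto_def
    by (simp only: coords_entry) (intro tendsto_sum tendsto_mult tendsto_const, auto)
  \<comment> \<open>The last index \<open>s\<close> of the bordered minor stands for row
    \<open>i\<close>, and in \<open>cj\<close> for column \<open>j\<close>.\<close>
  define ri where "ri a = (if a < s then a else i)" for a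
  define cj where "cj b = (if b < s then b else j)" for b
  have ri: "ri a < m" and cj: "cj a < n" for a using ij s_less_n n_le_m by (auto simp: ri_def cj_def)
  \<comment> \<open>Only the bordering row is divided by \<open>t k\<close>. Row \<open>i\<close> of
    \<open>coords X\<close> is zero because \<open>s \<le> i\<close>, so the rescaled row is a row
    of the difference quotient and converges to that of \<open>\<Xi>\<close>.\<close>
  define c where "c k a = (if a < s then 1 else 1 / t k)" for k a
  define F where "F k = mat (Suc s) m (\<lambda>(a,p). c k a * U $$ (p, ri a))" for k
  define G where "G = mat n (Suc s) (\<lambda>(q,b). V $$ (q, cj b))"
  \<comment> \<open>The first \<open>s\<close> rows of the limit are diagonal and only the last may
    be full. Hence \<open>L\<close> is lower triangular, with the wanted entry in its last corner
    and positive singular values before it.\<close>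
  define L where "L = mat (Suc s) (Suc s) (\<lambda>(a,b). if a < s then \<Sigma> $$ (a, cj b) else coords \<Xi> $$ (i, cj b))"
  have Fc: "F k \<in> carrier_mat (Suc s) m" and Gc: "G \<in> carrier_mat n (Suc s)"
    and Lc: "L \<in> carrier_mat (Suc s) (Suc s)" for k by (auto simp: F_def G_def L_def)
  have entry: "(F k * Xs k * G) $$ (a,b) = c k a * coords (Xs k) $$ (ri a, cj b)"
    if "a < Suc s" "b < Suc s" for k a b
  proof -
    have FX: "(F k * Xs k) $$ (a,q) = c k a * (\<Sum>p<m. U $$ (p, ri a) * Xs k $$ (p,q))" if "q < n" for q
      unfolding mult_entry[OF Fc Xc \<open>a < Suc s\<close> that] sum_distrib_left
      using \<open>a < Suc s\<close> by (intro sum.cong refl) (simp add: F_def)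
    show ?thesis
      unfolding mult_entry[OF mult_carrier_mat[OF Fc Xc] Gc that] coords_entry[OF Xc ri cj]
        sum_distrib_left[of "c k a"]
      using that by (intro sum.cong refl) (simp add: FX G_def)
  qed
  have scaled: "1 / t k * coords (Xs k) $$ (i, b) = coords ((1 / t k) \<cdot>\<^sub>m (Xs k - X)) $$ (i, b)"
    if b: "b < n" for k b
  proof -
    have "coords ((1 / t k) \<cdot>\<^sub>m (Xs k - X)) $$ (i, b) = 1 / t k * (coords (Xs k) $$ (i, b) - coords X $$ (i, b))"
      using coords_smult_diff[OF Xc X_carrier ij(2) b] .
    also have "coords X $$ (i, b) = 0" using coords_X \<Sigma>_zero[of i b] ij b by simp
    finally show ?thesis by simp
  qed
  have "(\<lambda>k. det (F k * Xs k * G)) \<longlonglongrightarrow> det L"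
  proof (rule det_tendsto[OF _ Lc])
    show "F k * Xs k * G \<in> carrier_mat (Suc s) (Suc s)" for k
      by (rule mult_carrier_mat[OF mult_carrier_mat[OF Fc Xc] Gc])
    fix a b assume ab: "a < Suc s" "b < Suc s"
    show "(\<lambda>k. (F k * Xs k * G) $$ (a,b)) \<longlonglongrightarrow> L $$ (a,b)"
    proof (cases "a < s")
      case True
      then show ?thesis
        using clim[OF ri cj Xs(2) Xc X_carrier, of a b] ab by (simp add: entry L_def ri_def c_def coords_X)
    next
      case False
      then show ?thesis
        using clim[OF ri cj lim Dc \<Xi>c, of a b] ab
        by (simp only: entry c_def if_False ri_def scaled[OF cj]) (simp add: L_def)
    qed
  qed
  moreover have "det (F k * Xs k * G) = 0" for k
    by (rule det_mult_low_mrank[OF Xc Xr Fc Gc])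
  ultimately have "det L = 0" by (simp add: LIMSEQ_const_iff)
  moreover have "det L = prod_list (diag_mat L)"
    using ij s_less_n n_le_m
    by (intro det_lower_triangular[OF _ Lc]) (auto simp: L_def cj_def intro!: \<Sigma>_zero)
  ultimately have "(\<Prod>a<Suc s. L $$ (a,a)) = 0"
    using Lc by (simp add: prod_list_diag_prod atLeast0LessThan)
  moreover have "(\<Prod>a<s. L $$ (a,a)) \<noteq> 0"
    using \<Sigma>_pos by (auto simp: L_def cj_def less_imp_neq[symmetric])
  ultimately have "L $$ (s,s) = 0" by simp
  then show ?thesis by (simp add: L_def cj_def)
qed

text \<open>In singular coordinates \<open>Y\<close> and any tangent have disjoint supports, so
  every term of their inner product is zero.\<close>

lemma normal_lowrankI:
  assumes Y: "Y \<in> carrier_mat m n" and "Y * transpose_mat Q = 0\<^sub>m m s" and "transpose_mat P * Y = 0\<^sub>m s n"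
  shows "Y \<in> frechet_normal m n (lowrank m n s) X"
proof -
  have "frob_inner Y \<Xi> = 0" if \<Xi>: "\<Xi> \<in> bouligand_tangent m n (lowrank m n s) X" for \<Xi>
  proof -
    have \<Xi>c: "\<Xi> \<in> carrier_mat m n" using \<Xi> by (simp add: bouligand_tangent_def)
    have "coords Y $$ (i,j) * coords \<Xi> $$ (i,j) = 0" if "i < m" "j < n" for i j
      using that coords_zero_right[OF Y assms(2), of i j] coords_zero_left[OF Y assms(3), of i j]
        tangent_lowrank_coords_zero[OF \<Xi>, of i j] by (cases "i < s"; cases "j < s") auto
    then show ?thesis
      unfolding frob_inner_coords[OF Y \<Xi>c] frob_inner_carrier[OF coords_carrier[OF Y]]
      by (intro sum.neutral ballI) simp
  qed
  then show ?thesis using Y by (simp add: frechet_normal_def)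
qed

end

section \<open>Normals to the feasible set\<close>

text \<open>Along a line the difference quotient is constant, so \<open>H\<close> and its negative
  are both tangent and the two inequalities for \<open>Y\<close> give equality.\<close>

lemma line_direction_normal_zero:
  assumes X: "X \<in> carrier_mat m n" and H: "H \<in> carrier_mat m n" and \<Omega>: "\<Omega> \<subseteq> carrier_mat m n"
    and Y: "Y \<in> frechet_normal m n \<Omega> X" and line: "\<And>t. X + t \<cdot>\<^sub>m H \<in> \<Omega>"
  shows "frob_inner Y H = 0"
proof -
  have Yc: "Y \<in> carrier_mat m n" using Y by (simp add: frechet_normal_def)
  have "c * frob_inner Y H \<le> 0" for c
  proof -
    have "c \<cdot>\<^sub>m H \<in> bouligand_tangent m n \<Omega> X"
    proof (rule bouligand_tangentI[OF X _ \<Omega>, where Xs = "\<lambda>k. X + (c * inverse (real (Suc k))) \<cdot>\<^sub>m H"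
          and t = "\<lambda>k. inverse (real (Suc k))"])
      show "(\<lambda>k. inverse (real (Suc k))) \<longlonglongrightarrow> 0" by (rule LIMSEQ_inverse_real_of_nat)
      fix i j assume "i < m" "j < n"
      then have "((X + (c * inverse (real (Suc k))) \<cdot>\<^sub>m H) $$ (i,j) - X $$ (i,j)) / inverse (real (Suc k))
        = (c \<cdot>\<^sub>m H) $$ (i,j)" for k using X H by (simp add: field_simps)
      then show "(\<lambda>k. ((X + (c * inverse (real (Suc k))) \<cdot>\<^sub>m H) $$ (i,j) - X $$ (i,j)) / inverse (real (Suc k)))
        \<longlonglongrightarrow> (c \<cdot>\<^sub>m H) $$ (i,j)" by simp
    qed (use H line in auto)
    then have "frob_inner Y (c \<cdot>\<^sub>m H) \<le> 0" using Y by (simp add: frechet_normal_def)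
    then show ?thesis by (simp add: frob_inner_smult_right[OF Yc H])
  qed
  from this[of 1] this[of "-1"] show ?thesis by simp
qed

lemma affL_add:
  assumes A: "\<forall>i<l. A i \<in> carrier_mat m n" and X: "X \<in> affL m n l A b" and H: "H \<in> carrier_mat m n"
    and 0: "\<And>k. k < l \<Longrightarrow> frob_inner (A k) H = 0"
  shows "X + H \<in> affL m n l A b"
proof -
  have "frob_inner (A k) (X + H) = b k" if "k < l" for k
    using frob_inner_add_right[of "A k" m n X H] A X H 0[OF that] that by (simp add: affL_def)
  then show ?thesis using X H by (simp add: affL_def)
qed

lemma mrank_add_le:
  assumes "A \<in> carrier_mat m n" "B \<in> carrier_mat m n"
  shows "mrank (A + B) \<le> mrank A + mrank B"
  using vec_space.rank_subadditive[OF assms] assms by (simp add: mrank_def)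

lemma linear_functional_frob_inner:
  assumes Y: "Y \<in> carrier_mat m n"
    and lin: "\<And>u v a i j. i < m \<Longrightarrow> j < n \<Longrightarrow>
      H (\<lambda>x. u x + a * v x) $$ (i,j) = H u $$ (i,j) + a * H v $$ (i,j)"
  shows "linear_functional (\<lambda>x. frob_inner Y (H x))"
  unfolding linear_functional_def
proof (intro allI)
  fix u v a
  have "frob_inner Y (H (\<lambda>x. u x + a * v x)) =
    (\<Sum>i<m. \<Sum>j<n. Y $$ (i,j) * H u $$ (i,j) + a * (Y $$ (i,j) * H v $$ (i,j)))"
    unfolding frob_inner_carrier[OF Y] by (intro sum.cong refl) (simp add: lin algebra_simps)
  also have "\<dots> = frob_inner Y (H u) + a * frob_inner Y (H v)"
    unfolding frob_inner_carrier[OF Y] by (simp add: sum.distrib sum_distrib_left)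
  finally show "frob_inner Y (H (\<lambda>x. u x + a * v x)) = frob_inner Y (H u) + a * frob_inner Y (H v)" .
qed

section \<open>The rank-deficient case\<close>

context svd_point
begin

text \<open>Perturbations \<open>W * Q\<close> fix the multipliers \<open>y\<close>. Any rank-one
  matrix can then be completed by some \<open>W * Q\<close> to a direction satisfying the
  constraints, so \<open>Y\<close> minus its multiplier combination is orthogonal to every rank-one
  matrix and hence zero.\<close>

lemma normal_subset_normL_of_rank_deficient:
  assumes A: "\<forall>i<l. A i \<in> carrier_mat m n" and X: "X \<in> affL m n l A b" and sr: "s < r"
    and indep: "lin_indep_mats m s l (\<lambda>i. R_mat s U V (A i))"
  shows "frechet_normal m n (affL m n l A b \<inter> lowrank m n r) X \<subseteq> normL m n l A"
proof
  fix Y assume Y: "Y \<in> frechet_normal m n (affL m n l A b \<inter> lowrank m n r) X"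
  have Yc: "Y \<in> carrier_mat m n" using Y by (simp add: frechet_normal_def)
  have WQc: "mat m s x * Q \<in> carrier_mat m n" for x :: "nat \<times> nat \<Rightarrow> real"
    by (rule mult_carrier_mat[OF _ Q_carrier]) simp
  define f where "f k x = frob_inner (A k) (mat m s x * Q)" for k and x :: "nat \<times> nat \<Rightarrow> real"
  have lin: "linear_functional (\<lambda>x. frob_inner B (mat m s x * Q))" if "B \<in> carrier_mat m n" for B
  proof (rule linear_functional_frob_inner[OF that])
    fix u v :: "nat \<times> nat \<Rightarrow> real" and a i j assume ij: "i < m" "j < n"
    have e: "(mat m s x * Q) $$ (i,j) = (\<Sum>k<s. x (i,k) * Q $$ (k,j))" for x :: "nat \<times> nat \<Rightarrow> real"
      using ij by (subst mult_entry[OF mat_carrier Q_carrier ij]) simp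
    show "(mat m s (\<lambda>x. u x + a * v x) * Q) $$ (i,j)
      = (mat m s u * Q) $$ (i,j) + a * (mat m s v * Q) $$ (i,j)"
      unfolding e by (simp add: algebra_simps sum.distrib sum_distrib_left)
  qed
  \<comment> \<open>Taking the perturbation equal to \<open>B * transpose_mat Q\<close> itself turns
    the hypothesis into a vanishing squared norm.\<close>
  have annih: "B * transpose_mat Q = 0\<^sub>m m s"
    if B: "B \<in> carrier_mat m n" and 0: "\<And>x. frob_inner B (mat m s x * Q) = 0" for B
  proof -
    have c: "B * transpose_mat Q \<in> carrier_mat m s" using B by (rule mult_carrier_mat) simp
    have "frob_inner (B * transpose_mat Q) (B * transpose_mat Q) = frob_inner B (B * transpose_mat Q * Q)"
      by (rule frob_inner_mult_right[OF B c Q_carrier, symmetric])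
    also have "B * transpose_mat Q = mat m s (\<lambda>p. (B * transpose_mat Q) $$ p)"
      using c by (intro eq_matI) auto
    then have "frob_inner B (B * transpose_mat Q * Q) = 0" using 0 by metis
    finally show ?thesis by (rule frob_inner_self_eq_0[OF c])
  qed
  have flin: "linear_functional (f k)" if "k < l" for k
    unfolding f_def using lin A that by blast
  have "\<exists>w. \<forall>k<l. \<forall>j<l. f k (w j) = (if k = j then 1 else 0)"
  proof (rule dual_basis_exists[OF flin])
    fix c assume c: "\<And>u. (\<Sum>k<l. c k * f k u) = 0"
    \<comment> \<open>A relation among the functionals is a combination of the \<open>A k\<close>
      orthogonal to all \<open>W * Q\<close>. Its first \<open>s\<close> columns in singular
      coordinates vanish, which is a relation among the \<open>R_mat\<close>.\<close>
    have "mat_comb m n l A c * transpose_mat Q = 0\<^sub>m m s"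
      using c by (intro annih mat_comb_carrier) (simp add: frob_inner_mat_comb[OF A] f_def)
    then have "coords (mat_comb m n l A c) $$ (i,j) = 0" if "i < m" "j < s" for i j
      using coords_zero_right[OF mat_comb_carrier _ that] by blast
    then have "(\<Sum>k<l. c k * R_mat s U V (A k) $$ (i,j)) = 0" if "i < m" "j < s" for i j
      using that A s_less_n by (simp add: R_mat_entry coords_mat_comb)
    then show "\<forall>k<l. c k = 0" using indep unfolding lin_indep_mats_def by blast
  qed
  then obtain w where w: "\<And>k j. k < l \<Longrightarrow> j < l \<Longrightarrow> f k (w j) = (if k = j then 1 else 0)" by blast
  \<comment> \<open>The line through \<open>X\<close> is
    \<open>(P + t * W) * Q + (t * Z1) * Z2\<close>, with \<open>W\<close> the matrix of
    \<open>x\<close>; its rank is at most \<open>s + 1\<close>, hence at most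
    \<open>r\<close>.\<close>
  have orth: "frob_inner Y (Z1 * Z2 + mat m s x * Q) = 0"
    if Z: "Z1 \<in> carrier_mat m 1" "Z2 \<in> carrier_mat 1 n"
      and 0: "\<And>k. k < l \<Longrightarrow> frob_inner (A k) (Z1 * Z2 + mat m s x * Q) = 0" for Z1 Z2 x
  proof -
    define H where "H = Z1 * Z2 + mat m s x * Q"
    have Zc: "Z1 * Z2 \<in> carrier_mat m n" using Z by (rule mult_carrier_mat)
    have Hc: "H \<in> carrier_mat m n" unfolding H_def by (rule add_carrier_mat[OF WQc])
    have "X + t \<cdot>\<^sub>m H \<in> lowrank m n r" for t
    proof -
      have tZ: "t \<cdot>\<^sub>m Z1 \<in> carrier_mat m 1" using Z by simp
      have tx: "t \<cdot>\<^sub>m mat m s x \<in> carrier_mat m s" by simp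
      have PW: "P + t \<cdot>\<^sub>m mat m s x \<in> carrier_mat m s" by simp
      have "X + t \<cdot>\<^sub>m H = (P + t \<cdot>\<^sub>m mat m s x) * Q + (t \<cdot>\<^sub>m Z1) * Z2"
      proof -
        have "(P + t \<cdot>\<^sub>m mat m s x) * Q = X + t \<cdot>\<^sub>m (mat m s x * Q)"
          using add_mult_distrib_mat[OF P_carrier tx Q_carrier] mult_smult_assoc_mat[OF mat_carrier Q_carrier]
          by (metis X_factorization)
        moreover have "(t \<cdot>\<^sub>m Z1) * Z2 = t \<cdot>\<^sub>m (Z1 * Z2)" by (rule mult_smult_assoc_mat[OF Z])
        moreover have "t \<cdot>\<^sub>m H = t \<cdot>\<^sub>m (Z1 * Z2) + t \<cdot>\<^sub>m (mat m s x * Q)"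
          unfolding H_def by (rule add_smult_distrib_left_mat[OF Zc WQc])
        moreover have "t \<cdot>\<^sub>m (Z1 * Z2) \<in> carrier_mat m n" "t \<cdot>\<^sub>m (mat m s x * Q) \<in> carrier_mat m n"
          using Zc WQc by simp_all
        ultimately show ?thesis
          using comm_add_mat assoc_add_mat[OF X_carrier] by metis
      qed
      moreover have "mrank ((P + t \<cdot>\<^sub>m mat m s x) * Q + (t \<cdot>\<^sub>m Z1) * Z2) \<le> s + 1"
        by (rule order_trans[OF mrank_add_le[OF mult_carrier_mat[OF PW Q_carrier] mult_carrier_mat[OF tZ Z(2)]]
            add_mono[OF mrank_mult_le[OF PW Q_carrier] mrank_mult_le[OF tZ Z(2)]]])
      ultimately have "mrank (X + t \<cdot>\<^sub>m H) \<le> r" using sr by simp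
      then show ?thesis using Hc by (simp add: lowrank_def)
    qed
    moreover have "X + t \<cdot>\<^sub>m H \<in> affL m n l A b" for t
    proof (rule affL_add[OF A X])
      fix k assume "k < l"
      then show "frob_inner (A k) (t \<cdot>\<^sub>m H) = 0"
        using frob_inner_smult_right[of "A k" m n H t] A Hc 0 by (simp add: H_def)
    qed (use Hc in simp)
    ultimately have "frob_inner Y H = 0"
      by (intro line_direction_normal_zero[OF X_carrier Hc _ Y]) (auto simp: affL_def)
    then show ?thesis by (simp add: H_def)
  qed
  define y where "y k = frob_inner Y (mat m s (w k) * Q)" for k
  define Y' where "Y' = Y - mat_comb m n l A y"
  have Y'c: "Y' \<in> carrier_mat m n" unfolding Y'_def by (rule minus_carrier_mat[OF mat_comb_carrier])
  have Y'_inner: "frob_inner Y' Z = frob_inner Y Z - (\<Sum>k<l. y k * frob_inner (A k) Z)" for Z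
    unfolding Y'_def frob_inner_minus_left[OF Yc mat_comb_carrier] frob_inner_mat_comb[OF A] ..
  have Y'W: "frob_inner Y' (mat m s x * Q) = 0" for x
  proof -
    have "frob_inner Y (mat m s x * Q) = (\<Sum>k<l. y k * f k x)"
      unfolding y_def
    proof (rule functional_in_span[OF flin lin[OF Yc] w])
      fix u assume u: "\<And>k. k < l \<Longrightarrow> f k u = 0"
      have "0\<^sub>m m 1 * 0\<^sub>m 1 n + mat m s u * Q = mat m s u * Q"
        using WQc[of u] by simp
      then show "frob_inner Y (mat m s u * Q) = 0"
        using orth[of "0\<^sub>m m 1" "0\<^sub>m 1 n" u] u by (simp add: f_def)
    qed
    then show ?thesis by (simp add: Y'_inner f_def)
  qed
  have Y'Z: "frob_inner Y' (Z1 * Z2) = 0" if Z: "Z1 \<in> carrier_mat m 1" "Z2 \<in> carrier_mat 1 n" for Z1 Z2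
  proof -
    have Zc: "Z1 * Z2 \<in> carrier_mat m n" using Z by (rule mult_carrier_mat)
    \<comment> \<open>The dual directions are combined so as to cancel the constraint values of
      \<open>Z1 * Z2\<close>; the leading 0 matches the shape of
      \<open>linear_functional_add_sum\<close>.\<close>
    define x where "x = (\<lambda>e. 0 + (\<Sum>j<l. - frob_inner (A j) (Z1 * Z2) * w j e))"
    have fx: "f k x = - frob_inner (A k) (Z1 * Z2)" if "k < l" for k
    proof -
      have "(\<Sum>j<l. - frob_inner (A j) (Z1 * Z2) * f k (w j))
        = (\<Sum>j<l. if k = j then - frob_inner (A j) (Z1 * Z2) else 0)"
        using that by (intro sum.cong) (auto simp: w)
      then show ?thesis
        unfolding x_def linear_functional_add_sum[OF flin[OF that]] linear_functional_zero[OF flin[OF that]]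
        using that by simp
    qed
    have H0: "frob_inner (A k) (Z1 * Z2 + mat m s x * Q) = 0" if "k < l" for k
      using fx[OF that] frob_inner_add_right[OF _ Zc WQc] A that by (simp add: f_def)
    then have "frob_inner Y' (Z1 * Z2 + mat m s x * Q) = 0"
      using orth[OF Z] by (simp add: Y'_inner)
    then show ?thesis using frob_inner_add_right[OF Y'c Zc WQc] Y'W by simp
  qed
  have Y'0: "Y' $$ (i,j) = 0" if ij: "i < m" "j < n" for i j
  proof -
    \<comment> \<open>A matrix unit has rank one, and its inner product with \<open>Y'\<close> reads
      off a single entry.\<close>
    define Z1 :: "real mat" where "Z1 = mat m 1 (\<lambda>(a,_). if a = i then 1 else 0)"
    define Z2 :: "real mat" where "Z2 = mat 1 n (\<lambda>(_,b). if b = j then 1 else 0)"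
    have Z: "Z1 \<in> carrier_mat m 1" "Z2 \<in> carrier_mat 1 n" by (auto simp: Z1_def Z2_def)
    have e: "(Z1 * Z2) $$ (a,b) = (if a = i then if b = j then 1 else 0 else 0)" if "a < m" "b < n" for a b
      using that by (simp add: mult_entry[OF Z that]) (simp add: Z1_def Z2_def)
    have "frob_inner Y' (Z1 * Z2) = (\<Sum>a<m. \<Sum>b<n. if a = i then if b = j then Y' $$ (i,j) else 0 else 0)"
      unfolding frob_inner_carrier[OF Y'c] by (intro sum.cong refl) (auto simp: e)
    also have "\<dots> = (\<Sum>a<m. if a = i then Y' $$ (i,j) else 0)"
      using ij by (intro sum.cong refl) auto
    also have "\<dots> = Y' $$ (i,j)" using ij by simp
    finally show ?thesis using Y'Z[OF Z] by simp
  qed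
  have "Y = mat_comb m n l A y"
  proof (rule eq_matI)
    fix i j assume "i < dim_row (mat_comb m n l A y)" "j < dim_col (mat_comb m n l A y)"
    then have ij: "i < m" "j < n" by (auto simp: mat_comb_def)
    then have "Y' $$ (i,j) = Y $$ (i,j) - mat_comb m n l A y $$ (i,j)"
      using Yc by (simp add: Y'_def mat_comb_def)
    then show "Y $$ (i,j) = mat_comb m n l A y $$ (i,j)" using Y'0[OF ij] by simp
  qed (use Yc in \<open>auto simp: mat_comb_def\<close>)
  then show "Y \<in> normL m n l A" by (simp add: normL_eq_range)
qed

section \<open>The full-rank case: curves through perturbed factors\<close>

text \<open>A perturbation \<open>(P', Q')\<close> of the factors of \<open>X = P Q\<close> is stored in one vector indexed by
  \<open>bool \<times> nat \<times> nat\<close>; the tag tells \<open>P'\<close> from \<open>Q'\<close>.\<close>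

definition lfac :: "(bool \<times> nat \<times> nat \<Rightarrow> real) \<Rightarrow> real mat" where
  "lfac x = mat m s (\<lambda>(i,j). x (True,i,j))"

definition rfac :: "(bool \<times> nat \<times> nat \<Rightarrow> real) \<Rightarrow> real mat" where
  "rfac x = mat s n (\<lambda>(i,j). x (False,i,j))"

text \<open>The derivative of the product map at \<open>(P, Q)\<close> in the direction
  \<open>x\<close>.\<close>

definition dfac :: "(bool \<times> nat \<times> nat \<Rightarrow> real) \<Rightarrow> real mat" where
  "dfac x = lfac x * Q + P * rfac x"

lemma lfac_carrier [simp]: "lfac x \<in> carrier_mat m s" and rfac_carrier [simp]: "rfac x \<in> carrier_mat s n"
  by (auto simp: lfac_def rfac_def)

lemma dfac_carrier [simp]: "dfac x \<in> carrier_mat m n"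
  unfolding dfac_def by (rule add_carrier_mat[OF mult_carrier_mat[OF P_carrier rfac_carrier]])

lemma dfac_entry:
  assumes ij: "i < m" "j < n"
  shows "dfac x $$ (i,j) = (\<Sum>k<s. x (True,i,k) * Q $$ (k,j)) + (\<Sum>k<s. P $$ (i,k) * x (False,k,j))"
proof -
  have "dfac x $$ (i,j) = (lfac x * Q) $$ (i,j) + (P * rfac x) $$ (i,j)"
    unfolding dfac_def using ij by (intro index_add_mat(1)) (auto simp: rfac_def)
  then show ?thesis
    unfolding mult_entry[OF lfac_carrier Q_carrier ij] mult_entry[OF P_carrier rfac_carrier ij]
    using ij by (simp add: lfac_def rfac_def)
qed

lemma fac_prod_entry:
  assumes ij: "i < m" "j < n"
  shows "(lfac x * rfac y) $$ (i,j) = (\<Sum>k<s. x (True,i,k) * y (False,k,j))"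
  unfolding mult_entry[OF lfac_carrier rfac_carrier ij] using ij by (simp add: lfac_def rfac_def)

lemma linear_functional_dfac:
  assumes "B \<in> carrier_mat m n"
  shows "linear_functional (\<lambda>x. frob_inner B (dfac x))"
  by (rule linear_functional_frob_inner[OF assms])
    (simp add: dfac_entry algebra_simps sum.distrib sum_distrib_left)

lemma linear_functional_fac_prod_left:
  assumes "B \<in> carrier_mat m n"
  shows "linear_functional (\<lambda>x. frob_inner B (lfac x * rfac y))"
  by (rule linear_functional_frob_inner[OF assms])
    (simp add: fac_prod_entry algebra_simps sum.distrib sum_distrib_left)

lemma linear_functional_fac_prod_right:
  assumes "B \<in> carrier_mat m n"
  shows "linear_functional (\<lambda>y. frob_inner B (lfac x * rfac y))"
  by (rule linear_functional_frob_inner[OF assms])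
    (simp add: fac_prod_entry algebra_simps sum.distrib sum_distrib_left)

text \<open>Testing against the image of \<open>B\<close> under the adjoint of \<open>dfac\<close>,
  the pair of \<open>B * transpose_mat Q\<close> and \<open>transpose_mat P * B\<close>, yields the
  sum of two squared norms.\<close>

lemma dfac_annihilator:
  assumes B: "B \<in> carrier_mat m n" and 0: "\<And>x. frob_inner B (dfac x) = 0"
  shows "B * transpose_mat Q = 0\<^sub>m m s" "transpose_mat P * B = 0\<^sub>m s n"
proof -
  define x :: "bool \<times> nat \<times> nat \<Rightarrow> real" where
    "x = (\<lambda>(b,p). if b then (B * transpose_mat Q) $$ p else (transpose_mat P * B) $$ p)"
  have c1: "B * transpose_mat Q \<in> carrier_mat m s" using B by (rule mult_carrier_mat) simp
  have c2: "transpose_mat P * B \<in> carrier_mat s n" by (rule mult_carrier_mat[OF _ B]) simp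
  have l: "lfac x = B * transpose_mat Q" using c1 by (intro eq_matI) (auto simp: lfac_def x_def)
  have r: "rfac x = transpose_mat P * B" using c2 by (intro eq_matI) (auto simp: rfac_def x_def)
  have "frob_inner B (dfac x) = frob_inner B (lfac x * Q) + frob_inner B (P * rfac x)"
    unfolding dfac_def
    by (rule frob_inner_add_right[OF B mult_carrier_mat[OF lfac_carrier Q_carrier]
          mult_carrier_mat[OF P_carrier rfac_carrier]])
  also have "\<dots> = frob_inner (lfac x) (lfac x) + frob_inner (rfac x) (rfac x)"
    using frob_inner_mult_right[OF B lfac_carrier Q_carrier, of x]
      frob_inner_mult_left[OF B P_carrier rfac_carrier, of x] by (simp only: l r)
  finally have "frob_inner (lfac x) (lfac x) = 0" "frob_inner (rfac x) (rfac x) = 0"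
    using 0[of x] frob_inner_self_nonneg[of "lfac x"] frob_inner_self_nonneg[of "rfac x"] by linarith+
  then show "B * transpose_mat Q = 0\<^sub>m m s" "transpose_mat P * B = 0\<^sub>m s n"
    using frob_inner_self_eq_0[OF lfac_carrier] frob_inner_self_eq_0[OF rfac_carrier] l r by metis+
qed

text \<open>The expansion is exact with a bilinear remainder: the right side makes the constraints
  quadratic in the perturbation, and the left side bounds the rank by \<open>s\<close>.\<close>

lemma perturbed_factors:
  "(P + t \<cdot>\<^sub>m lfac y) * (Q + t \<cdot>\<^sub>m rfac y) = X + t \<cdot>\<^sub>m (dfac y + t \<cdot>\<^sub>m (lfac y * rfac y))"
proof (rule eq_matI)
  fix i j
  assume "i < dim_row (X + t \<cdot>\<^sub>m (dfac y + t \<cdot>\<^sub>m (lfac y * rfac y)))"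
    and "j < dim_col (X + t \<cdot>\<^sub>m (dfac y + t \<cdot>\<^sub>m (lfac y * rfac y)))"
  then have ij: "i < m" "j < n" by (auto simp: lfac_def rfac_def)
  have "((P + t \<cdot>\<^sub>m lfac y) * (Q + t \<cdot>\<^sub>m rfac y)) $$ (i,j)
    = (\<Sum>k<s. (P $$ (i,k) + t * y (True,i,k)) * (Q $$ (k,j) + t * y (False,k,j)))"
    using ij
    by (subst mult_entry[of _ m s _ n]) (auto simp: lfac_def rfac_def intro!: sum.cong)
  also have "\<dots> = (\<Sum>k<s. P $$ (i,k) * Q $$ (k,j) + (t * (y (True,i,k) * Q $$ (k,j)) + t * (P $$ (i,k) * y (False,k,j))
     + t * (t * (y (True,i,k) * y (False,k,j)))))"
    by (intro sum.cong refl) (simp add: algebra_simps)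
  also have "\<dots> = X $$ (i,j) + t * (dfac y $$ (i,j) + t * (lfac y * rfac y) $$ (i,j))"
  proof -
    have "X $$ (i,j) = (\<Sum>k<s. P $$ (i,k) * Q $$ (k,j))"
      using mult_entry[OF P_carrier Q_carrier ij] X_factorization by simp
    then show ?thesis
      unfolding dfac_entry[OF ij] fac_prod_entry[OF ij]
      by (simp add: sum.distrib sum_distrib_left distrib_left)
  qed
  also have "\<dots> = (X + t \<cdot>\<^sub>m (dfac y + t \<cdot>\<^sub>m (lfac y * rfac y))) $$ (i,j)"
  proof -
    have "i < dim_row (dfac y)" "j < dim_col (dfac y)" "i < dim_row (lfac y)" "j < dim_col (rfac y)"
      using ij carrier_matD[OF dfac_carrier] carrier_matD[OF lfac_carrier] carrier_matD[OF rfac_carrier] by auto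
    then show ?thesis using ij by (simp del: index_mult_mat(1))
  qed
  finally show "((P + t \<cdot>\<^sub>m lfac y) * (Q + t \<cdot>\<^sub>m rfac y)) $$ (i,j)
    = (X + t \<cdot>\<^sub>m (dfac y + t \<cdot>\<^sub>m (lfac y * rfac y))) $$ (i,j)" .
qed (auto simp: lfac_def rfac_def)

text \<open>Along \<open>(P + t P\<^sub>y) (Q + t Q\<^sub>y)\<close> with \<open>y = x + t (\<Sum>\<^sub>j v\<^sub>j w\<^sub>j)\<close> the constraints, divided by
  \<open>t\<^sup>2\<close>, become \<open>v\<^sub>k = - \<langle>A\<^sub>k, P\<^sub>y Q\<^sub>y\<rangle>\<close>, a quadratic system solvable with bounded \<open>v\<close>.\<close>

lemma dfac_tangent:
  assumes A: "\<forall>i<l. A i \<in> carrier_mat m n" and X: "X \<in> affL m n l A b"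
    and w: "\<And>k j. k < l \<Longrightarrow> j < l \<Longrightarrow> frob_inner (A k) (dfac (w j)) = (if k = j then 1 else 0)"
    and x: "\<And>k. k < l \<Longrightarrow> frob_inner (A k) (dfac x) = 0"
  shows "dfac x \<in> bouligand_tangent m n (affL m n l A b \<inter> lowrank m n s) X"
proof -
  \<comment> \<open>The bilinear second-order part of constraint \<open>k\<close>. The coefficients
    passed to the quadratic system are those of \<open>- \<beta> k y y\<close> expanded at
    \<open>x\<close> plus \<open>t\<close> times a combination of the \<open>w j\<close>.\<close>
  define \<beta> where "\<beta> k x y = frob_inner (A k) (lfac x * rfac y)" for k x y
  obtain K \<delta> where \<delta>: "0 < \<delta>" and sol: "\<And>t. 0 < t \<Longrightarrow> t < \<delta> \<Longrightarrow> \<exists>v. \<forall>k<l. \<bar>v k\<bar> \<le> K \<and>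
    v k = - \<beta> k x x + t * (\<Sum>j<l. - (\<beta> k x (w j) + \<beta> k (w j) x) * v j)
      + t\<^sup>2 * (\<Sum>i<l. \<Sum>j<l. - \<beta> k (w i) (w j) * (v i * v j))"
    by (rule quadratic_system_solvable[where l = l and a = "\<lambda>k. - \<beta> k x x"
          and b = "\<lambda>k j. - (\<beta> k x (w j) + \<beta> k (w j) x)" and c = "\<lambda>k i j. - \<beta> k (w i) (w j)"]) (rule that)
  \<comment> \<open>Scaling by half of \<open>\<delta>\<close> keeps every step strictly below
    \<open>\<delta>\<close>, the first included.\<close>
  define t where "t q = \<delta> / 2 * inverse (real (Suc q))" for q
  have t_pos: "t q > 0" for q using \<delta> by (simp add: t_def)
  have t_less: "t q < \<delta>" for q
  proof -
    have "inverse (real (Suc q)) \<le> 1" by (simp add: field_simps)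
    then have "t q \<le> \<delta> / 2 * 1" unfolding t_def using \<delta> by (intro mult_left_mono) auto
    then show ?thesis using \<delta> by simp
  qed
  have t_lim: "t \<longlonglongrightarrow> 0"
    unfolding t_def using tendsto_mult_left[OF LIMSEQ_inverse_real_of_nat, of "\<delta> / 2"] by simp
  have "\<forall>q. \<exists>v. \<forall>k<l. \<bar>v k\<bar> \<le> K \<and>
    v k = - \<beta> k x x + t q * (\<Sum>j<l. - (\<beta> k x (w j) + \<beta> k (w j) x) * v j)
      + (t q)\<^sup>2 * (\<Sum>i<l. \<Sum>j<l. - \<beta> k (w i) (w j) * (v i * v j))"
    using sol[OF t_pos t_less] by (rule allI)
  from choice[OF this] obtain v where v: "\<And>q k. k < l \<Longrightarrow> \<bar>v q k\<bar> \<le> K \<and>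
    v q k = - \<beta> k x x + t q * (\<Sum>j<l. - (\<beta> k x (w j) + \<beta> k (w j) x) * v q j)
      + (t q)\<^sup>2 * (\<Sum>i<l. \<Sum>j<l. - \<beta> k (w i) (w j) * (v q i * v q j))" by blast
  note vK = v[THEN conjunct1] and veq = v[THEN conjunct2]
  define y where "y q = (\<lambda>e. x e + (\<Sum>j<l. (t q * v q j) * w j e))" for q
  have \<beta>y: "\<beta> k (y q) (y q) = - v q k" if k: "k < l" for k q
  proof -
    have Ak: "A k \<in> carrier_mat m n" using A k by blast
    have left: "\<beta> k (y q) z = \<beta> k x z + (\<Sum>i<l. (t q * v q i) * \<beta> k (w i) z)" for z
      unfolding \<beta>_def y_def by (rule linear_functional_add_sum[OF linear_functional_fac_prod_left[OF Ak, of z]])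
    have right: "\<beta> k z (y q) = \<beta> k z x + (\<Sum>j<l. (t q * v q j) * \<beta> k z (w j))" for z
      unfolding \<beta>_def y_def by (rule linear_functional_add_sum[OF linear_functional_fac_prod_right[OF Ak, of z]])
    have "\<beta> k (y q) (y q) = \<beta> k x x + (\<Sum>j<l. (t q * v q j) * \<beta> k x (w j))
      + ((\<Sum>i<l. (t q * v q i) * \<beta> k (w i) x) + (\<Sum>i<l. \<Sum>j<l. (t q * v q i) * ((t q * v q j) * \<beta> k (w i) (w j))))"
      by (subst left) (simp add: right distrib_left sum.distrib sum_distrib_left)
    also have "(\<Sum>i<l. \<Sum>j<l. (t q * v q i) * ((t q * v q j) * \<beta> k (w i) (w j)))
      = (t q)\<^sup>2 * (\<Sum>i<l. \<Sum>j<l. \<beta> k (w i) (w j) * (v q i * v q j))"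
      unfolding sum_distrib_left by (intro sum.cong refl) (simp add: power2_eq_square mult_ac)
    also have "\<beta> k x x + (\<Sum>j<l. (t q * v q j) * \<beta> k x (w j))
      + ((\<Sum>i<l. (t q * v q i) * \<beta> k (w i) x) + (t q)\<^sup>2 * (\<Sum>i<l. \<Sum>j<l. \<beta> k (w i) (w j) * (v q i * v q j)))
      = \<beta> k x x + t q * (\<Sum>j<l. (\<beta> k x (w j) + \<beta> k (w j) x) * v q j)
      + (t q)\<^sup>2 * (\<Sum>i<l. \<Sum>j<l. \<beta> k (w i) (w j) * (v q i * v q j))"
      by (simp add: distrib_right sum.distrib sum_distrib_left distrib_left mult_ac)
    also have "\<dots> = - v q k"
      by (subst veq[OF k]) (simp add: sum_negf del: minus_add_distrib)
    finally show ?thesis .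
  qed
  \<comment> \<open>The secant direction of the curve. Its first-order part contributes
    \<open>t q * v q k\<close> to constraint \<open>k\<close>, and the bilinear part contributes the
    negative of this.\<close>
  define Z where "Z q = dfac (y q) + t q \<cdot>\<^sub>m (lfac (y q) * rfac (y q))" for q
  have prodc: "lfac a * rfac a \<in> carrier_mat m n" for a
    by (rule mult_carrier_mat[OF lfac_carrier rfac_carrier])
  have Zc: "Z q \<in> carrier_mat m n" for q
    unfolding Z_def by (rule add_carrier_mat[OF smult_carrier_mat[OF prodc]])
  have tZc: "t q \<cdot>\<^sub>m Z q \<in> carrier_mat m n" for q using Zc by simp
  have Z0: "frob_inner (A k) (Z q) = 0" if k: "k < l" for k q
  proof -
    have Ak: "A k \<in> carrier_mat m n" using A k by blast
    have "frob_inner (A k) (dfac (y q)) = frob_inner (A k) (dfac x) + (\<Sum>j<l. (t q * v q j) * frob_inner (A k) (dfac (w j)))"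
      unfolding y_def by (rule linear_functional_add_sum[OF linear_functional_dfac[OF Ak]])
    also have "(\<Sum>j<l. (t q * v q j) * frob_inner (A k) (dfac (w j))) = (\<Sum>j<l. if k = j then t q * v q j else 0)"
      using k by (intro sum.cong refl) (auto simp: w)
    finally have "frob_inner (A k) (dfac (y q)) = t q * v q k" using x k by simp
    moreover have "frob_inner (A k) (Z q) = frob_inner (A k) (dfac (y q)) + t q * \<beta> k (y q) (y q)"
      unfolding Z_def \<beta>_def frob_inner_add_right[OF Ak dfac_carrier smult_carrier_mat[OF prodc]]
        frob_inner_smult_right[OF Ak prodc] ..
    ultimately show ?thesis using \<beta>y[OF k] by simp
  qed
  \<comment> \<open>The bound \<open>K\<close> is common to all \<open>q\<close>, so the correction
    \<open>t q * v q j\<close> tends to zero although \<open>v q\<close> itself need not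
    converge.\<close>
  have ylim: "(\<lambda>q. y q e) \<longlonglongrightarrow> x e" for e
  proof -
    have "(\<lambda>q. t q * v q j) \<longlonglongrightarrow> 0" if "j < l" for j
    proof (rule tendsto_rabs_zero_cancel, rule tendsto_sandwich[OF _ _ tendsto_const])
      show "(\<lambda>q. t q * K) \<longlonglongrightarrow> 0" using tendsto_mult_right[OF t_lim, of K] by simp
      show "\<forall>\<^sub>F q in sequentially. \<bar>t q * v q j\<bar> \<le> t q * K"
        using vK[OF that] t_pos by (intro always_eventually allI) (simp add: abs_mult abs_of_pos mult_left_mono less_imp_le)
    qed simp
    then have "(\<lambda>q. y q e) \<longlonglongrightarrow> x e + (\<Sum>j<l. 0 * w j e)"
      unfolding y_def by (intro tendsto_add tendsto_const tendsto_sum tendsto_mult_right) auto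
    then show ?thesis by simp
  qed
  show ?thesis
  proof (rule bouligand_tangentI[OF X_carrier dfac_carrier, where Xs = "\<lambda>q. X + t q \<cdot>\<^sub>m Z q" and t = t])
    show "affL m n l A b \<inter> lowrank m n s \<subseteq> carrier_mat m n" by (auto simp: affL_def)
    show "X + t q \<cdot>\<^sub>m Z q \<in> affL m n l A b \<inter> lowrank m n s" for q
    proof
      show "X + t q \<cdot>\<^sub>m Z q \<in> affL m n l A b"
      proof (rule affL_add[OF A X tZc])
        fix k assume k: "k < l"
        then show "frob_inner (A k) (t q \<cdot>\<^sub>m Z q) = 0"
          using frob_inner_smult_right[OF _ Zc] A Z0 by simp
      qed
      have "mrank ((P + t q \<cdot>\<^sub>m lfac (y q)) * (Q + t q \<cdot>\<^sub>m rfac (y q))) \<le> s"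
        by (rule mrank_mult_le[of _ m _ _ n]) simp_all
      then show "X + t q \<cdot>\<^sub>m Z q \<in> lowrank m n s"
        unfolding perturbed_factors Z_def[symmetric] using tZc by (simp add: lowrank_def)
    qed
    fix i j assume ij: "i < m" "j < n"
    have "(\<lambda>q. (\<Sum>k<s. y q (True,i,k) * Q $$ (k,j)) + (\<Sum>k<s. P $$ (i,k) * y q (False,k,j))
        + t q * (\<Sum>k<s. y q (True,i,k) * y q (False,k,j)))
      \<longlonglongrightarrow> (\<Sum>k<s. x (True,i,k) * Q $$ (k,j)) + (\<Sum>k<s. P $$ (i,k) * x (False,k,j))
        + 0 * (\<Sum>k<s. x (True,i,k) * x (False,k,j))"
      by (intro tendsto_intros t_lim ylim)
    moreover have "((X + t q \<cdot>\<^sub>m Z q) $$ (i,j) - X $$ (i,j)) / t q =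
      (\<Sum>k<s. y q (True,i,k) * Q $$ (k,j)) + (\<Sum>k<s. P $$ (i,k) * y q (False,k,j))
        + t q * (\<Sum>k<s. y q (True,i,k) * y q (False,k,j))" for q
    proof -
      have "(X + t q \<cdot>\<^sub>m Z q) $$ (i,j) = X $$ (i,j) + t q * Z q $$ (i,j)"
        using ij Zc[of q] by simp
      moreover have "Z q $$ (i,j) = dfac (y q) $$ (i,j) + t q * (lfac (y q) * rfac (y q)) $$ (i,j)"
        unfolding Z_def using ij prodc[of "y q"] by (simp del: index_mult_mat)
      ultimately show ?thesis
        using t_pos[of q] by (simp add: dfac_entry[OF ij] fac_prod_entry[OF ij])
    qed
    ultimately show "(\<lambda>q. ((X + t q \<cdot>\<^sub>m Z q) $$ (i,j) - X $$ (i,j)) / t q) \<longlonglongrightarrow> dfac x $$ (i,j)"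
      by (simp add: dfac_entry[OF ij])
  qed (use t_pos t_lim in auto)
qed

text \<open>The block that \<open>T_mat\<close> replaces by zero is the part of a matrix invisible
  to all \<open>dfac\<close> directions, so independence of the \<open>T_mat\<close> is independence
  of the constraints as functionals of the perturbation.\<close>

lemma normal_subset_sum_of_full_rank:
  assumes A: "\<forall>i<l. A i \<in> carrier_mat m n" and X: "X \<in> affL m n l A b"
    and indep: "lin_indep_mats m n l (\<lambda>i. T_mat m n s U V (A i))"
  shows "frechet_normal m n (affL m n l A b \<inter> lowrank m n s) X
    \<subseteq> mset_plus (normL m n l A) (frechet_normal m n (lowrank m n s) X)"
proof
  fix Y assume Y: "Y \<in> frechet_normal m n (affL m n l A b \<inter> lowrank m n s) X"
  have Yc: "Y \<in> carrier_mat m n" using Y by (simp add: frechet_normal_def)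
  have flin: "linear_functional (\<lambda>x. frob_inner (A k) (dfac x))" if "k < l" for k
    using linear_functional_dfac A that by blast
  have "\<exists>w. \<forall>k<l. \<forall>j<l. frob_inner (A k) (dfac (w j)) = (if k = j then 1 else 0)"
  proof (rule dual_basis_exists[OF flin])
    fix c assume c: "\<And>u. (\<Sum>k<l. c k * frob_inner (A k) (dfac u)) = 0"
    have "\<And>x. frob_inner (mat_comb m n l A c) (dfac x) = 0"
      using c by (simp add: frob_inner_mat_comb[OF A])
    note annih = dfac_annihilator[OF mat_comb_carrier this]
    have "coords (mat_comb m n l A c) $$ (i,j) = 0" if "i < m" "j < n" "i < s \<or> j < s" for i j
      using that coords_zero_right[OF mat_comb_carrier annih(1)] coords_zero_left[OF mat_comb_carrier annih(2)]
      by blast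
    then have "(\<Sum>k<l. c k * T_mat m n s U V (A k) $$ (i,j)) = 0" if "i < m" "j < n" for i j
      using that A by (cases "i < s \<or> j < s") (auto simp: T_mat_entry coords_mat_comb)
    then show "\<forall>k<l. c k = 0" using indep unfolding lin_indep_mats_def by blast
  qed
  then obtain w where w: "\<And>k j. k < l \<Longrightarrow> j < l \<Longrightarrow> frob_inner (A k) (dfac (w j)) = (if k = j then 1 else 0)"
    by blast
  define y where "y k = frob_inner Y (dfac (w k))" for k
  have span: "frob_inner Y (dfac x) = (\<Sum>k<l. y k * frob_inner (A k) (dfac x))" for x
    unfolding y_def
  proof (rule functional_in_span[OF flin linear_functional_dfac[OF Yc] w])
    fix u assume u: "\<And>k. k < l \<Longrightarrow> frob_inner (A k) (dfac u) = 0"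
    \<comment> \<open>The kernel of the constraints is a linear space, so scaling by 1 and by -1
      turns the normal inequality into an equality.\<close>
    have "c * frob_inner Y (dfac u) \<le> 0" for c
    proof -
      have "frob_inner (A k) (dfac (\<lambda>e. c * u e)) = 0" if "k < l" for k
        using linear_functional_scale[OF flin[OF that], of c u] u[OF that] by simp
      then have "frob_inner Y (dfac (\<lambda>e. c * u e)) \<le> 0"
        using dfac_tangent[OF A X w] Y by (simp add: frechet_normal_def)
      then show ?thesis using linear_functional_scale[OF linear_functional_dfac[OF Yc], of c u] by simp
    qed
    from this[of 1] this[of "-1"] show "frob_inner Y (dfac u) = 0" by simp
  qed
  define Y' where "Y' = Y - mat_comb m n l A y"
  have Y'c: "Y' \<in> carrier_mat m n" unfolding Y'_def by (rule minus_carrier_mat[OF mat_comb_carrier])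
  have "frob_inner Y' (dfac x) = 0" for x
    unfolding Y'_def frob_inner_minus_left[OF Yc mat_comb_carrier] frob_inner_mat_comb[OF A]
    using span by simp
  note annih = dfac_annihilator[OF Y'c this]
  have "Y' \<in> frechet_normal m n (lowrank m n s) X"
    by (rule normal_lowrankI[OF Y'c annih])
  moreover have "Y = mat_comb m n l A y + Y'"
    using Yc unfolding Y'_def by (intro eq_matI) (auto simp: mat_comb_def)
  moreover have "mat_comb m n l A y \<in> normL m n l A" by (simp add: normL_eq_range)
  ultimately show "Y \<in> mset_plus (normL m n l A) (frechet_normal m n (lowrank m n s) X)"
    unfolding mset_plus_def by blast
qed

end

theorem theorem3p1:
  fixes m n l r s :: nat and A :: "nat \<Rightarrow> real mat" and b :: "nat \<Rightarrow> real"
    and X U \<Sigma> V :: "real mat"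
  assumes "n \<le> m" and "r < n"
    and "\<forall>i<l. A i \<in> carrier_mat m n"
    and "X \<in> affL m n l A b \<inter> lowrank m n r"
    and "s = mrank X"
    and "is_svd m n X s U \<Sigma> V"
  shows "(s = r \<and> lin_indep_mats m n l (\<lambda>i. T_mat m n s U V (A i)) \<longrightarrow>
            frechet_normal m n (affL m n l A b \<inter> lowrank m n r) X
              = mset_plus (normL m n l A) (frechet_normal m n (lowrank m n r) X))
       \<and> (s < r \<and> lin_indep_mats m s l (\<lambda>i. R_mat s U V (A i)) \<longrightarrow>
            frechet_normal m n (affL m n l A b \<inter> lowrank m n r) X
              = mset_plus (normL m n l A) (frechet_normal m n (lowrank m n r) X)
            \<and> mset_plus (normL m n l A) (frechet_normal m n (lowrank m n r) X) = normL m n l A)"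
proof -
  note A = assms(3)
  have X: "X \<in> affL m n l A b" and Xr: "X \<in> lowrank m n r" using assms(4) by auto
  have "s \<le> r" using Xr assms(5) by (simp add: lowrank_def)
  then interpret svd_point m n s X U \<Sigma> V
    using assms(1,2,6) by unfold_locales auto
  have sup: "mset_plus (normL m n l A) (frechet_normal m n (lowrank m n r) X)
    \<subseteq> frechet_normal m n (affL m n l A b \<inter> lowrank m n r) X"
    by (rule normal_sum_subset[OF A X])
  show ?thesis
  proof (intro conjI impI; elim conjE)
    assume "s = r" "lin_indep_mats m n l (\<lambda>i. T_mat m n s U V (A i))"
    then show "frechet_normal m n (affL m n l A b \<inter> lowrank m n r) X
      = mset_plus (normL m n l A) (frechet_normal m n (lowrank m n r) X)"
      using normal_subset_sum_of_full_rank[OF A X] sup by blast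
  next
    assume sr: "s < r" and indep: "lin_indep_mats m s l (\<lambda>i. R_mat s U V (A i))"
    have sub: "frechet_normal m n (affL m n l A b \<inter> lowrank m n r) X \<subseteq> normL m n l A"
      by (rule normal_subset_normL_of_rank_deficient[OF A X sr indep])
    \<comment> \<open>With the zero normal, \<open>normL\<close> lies in the sum; the sum lies in
      the normal cone of the intersection, which lies in \<open>normL\<close>. This cycle gives both
      equalities.\<close>
    have zero: "0\<^sub>m m n \<in> frechet_normal m n (lowrank m n r) X"
      by (simp add: frechet_normal_def frob_inner_def)
    have "C \<in> mset_plus (normL m n l A) (frechet_normal m n (lowrank m n r) X)" if "C \<in> normL m n l A" for C
    proof -
      have "C + 0\<^sub>m m n = C" using that by (auto simp: normL_eq_range intro: right_add_zero_mat[OF mat_comb_carrier])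
      moreover have "C + 0\<^sub>m m n \<in> mset_plus (normL m n l A) (frechet_normal m n (lowrank m n r) X)"
        unfolding mset_plus_def using that zero by blast
      ultimately show ?thesis by simp
    qed
    then have "normL m n l A \<subseteq> mset_plus (normL m n l A) (frechet_normal m n (lowrank m n r) X)" by blast
    with sub sup
    show "frechet_normal m n (affL m n l A b \<inter> lowrank m n r) X
      = mset_plus (normL m n l A) (frechet_normal m n (lowrank m n r) X)"
      and "mset_plus (normL m n l A) (frechet_normal m n (lowrank m n r) X) = normL m n l A" by blast+
  qed
qed

end
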